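(* (i) The bivalent unicyclic graphs are the unicyclic graphs composed of chains $P_2$ connected by equal links that form only one cycle (eigenvalue $2$), and the even cycles (eigenvalue $4$). (ii) The trivalent unicyclic graphs are the unicyclic graphs obtained from the following graphs: - stars $S_{2k+1}$ with $0$ in the center and an equal number $k$ of vertices $+1$ and $-1$, with eigenvalue $1$; - the cycle $C_{4k}$, with eigenvalue $2$; - the cycle $C_{3k}$, with eigenvalue $3$; ($k\ge 1$ an integer) by adding equal links or extending with soft nodes, the resulting graph having no further cycle beyond the single one.
   Context: Graphs are finite, simple and undirected. A unicyclic graph is a connected graph containing exactly one cycle. The Laplacian of a graph $G$ is $L(G)=D-A$ ($D$ the diagonal matrix of degrees, $A$ the adjacency matrix). An eigenvector of $L(G)$ is bivalent if it is composed of the values $\{-1,+1\}$ and trivalent if it is composed of the values $\{-1,0,+1\}$ (the set of values of its entries is exactly the indicated set). A graph is bivalent (resp. trivalent) if its Laplacian has a bivalent (resp. trivalent) eigenvector; the eigenvalue mentioned is the one afforded by that eigenvector. A soft node is a vertex of value $0$. The basic graphs carry the following vectors: $P_2$ (path on two vertices) carries $[1,-1]^T$; $S_{2k+1}$ (star with a center and $2k$ leaves) carries $0$ at the center, $+1$ at $k$ leaves and $-1$ at the other $k$; $C_{4k}$ (cycle on $4k$ vertices) carries, in cyclic order, repetitions of $(1,0,-1,0)$; $C_{3k}$ carries repetitions of $(1,0,-1)$; an even cycle $C_{2k}$, $k\ge2$, carries repetitions of $(1,-1)$. An equal link is an edge joining two vertices with the same value; adding equal links to (a disjoint union of) graphs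 carrying vectors means adding edges between vertices of equal value in the combined vector. Extending with soft nodes means adding new vertices of value $0$ connected to already present vertices of value $0$.
   Formalization: In (ii), for eigenvalue 2, equal links may also join disjoint paths P_2 carrying (1,-1) to the graph built from C_{4k}; without them the claim fails, e.g. for C_4 with a pendant two-vertex path at each of two adjacent vertices. *)

theory Defs
  imports "HOL-Analysis.Analysis"
begin

text \<open>A simple graph is given by its set of edges, an edge being a two-element set of
  vertices.  The whole graph has a finite type \<open>'a\<close> as its vertex set; the pieces it is
  assembled from have an explicit vertex set \<open>V\<close> in addition to their edge set.\<close>

definition simple_graph :: "'a set set \<Rightarrow> bool" where
  "simple_graph E \<longleftrightarrow> (\<forall>e\<in>E. card e = 2)"

definition connected_graph :: "'a set set \<Rightarrow> bool" where
  "connected_graph E \<longleftrightarrow> (\<forall>u v. (u, v) \<in> {(a, b). {a, b} \<in> E}\<^sup>*)"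

definition cycle_edges :: "'a list \<Rightarrow> 'a set set" where
  "cycle_edges c = {{c ! i, c ! (Suc i mod length c)} | i. i < length c}"

definition cycle_on :: "'a list \<Rightarrow> 'a set \<Rightarrow> 'a set set \<Rightarrow> bool" where
  "cycle_on c V E \<longleftrightarrow>
     distinct c \<and> 3 \<le> length c \<and> V = set c \<and> E = cycle_edges c"

text \<open>Cycles are counted as subgraphs, that is, by their edge sets, so that different starting
  points and orientations of the same cycle are identified.\<close>

definition unicyclic :: "'a set set \<Rightarrow> bool" where
  "unicyclic E \<longleftrightarrow> connected_graph E \<and> (\<exists>!C. C \<subseteq> E \<and> (\<exists>c V. cycle_on c V C))"

definition even_cycle :: "'a set set \<Rightarrow> bool" where
  "even_cycle E \<longleftrightarrow> (\<exists>c. cycle_on c UNIV E \<and> even (length c))"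

definition degree_matrix :: "'a::finite set set \<Rightarrow> real ^ 'a ^ 'a" where
  "degree_matrix E = (\<chi> i j. if i = j then real (card {w. {i, w} \<in> E}) else 0)"

definition adjacency_matrix :: "'a::finite set set \<Rightarrow> real ^ 'a ^ 'a" where
  "adjacency_matrix E = (\<chi> i j. if {i, j} \<in> E then 1 else 0)"

definition laplacian :: "'a::finite set set \<Rightarrow> real ^ 'a ^ 'a" where
  "laplacian E = degree_matrix E - adjacency_matrix E"

definition is_eigenvector :: "real ^ 'a ^ 'a \<Rightarrow> real ^ 'a \<Rightarrow> real \<Rightarrow> bool" where
  "is_eigenvector A x \<mu> \<longleftrightarrow> x \<noteq> 0 \<and> A *v x = \<mu> *\<^sub>R x"

definition bivalent_with :: "'a::finite set set \<Rightarrow> real \<Rightarrow> bool" where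
  "bivalent_with E \<mu> \<longleftrightarrow>
     (\<exists>x. is_eigenvector (laplacian E) x \<mu> \<and> range (($) x) = {-1, 1})"

definition trivalent_with :: "'a::finite set set \<Rightarrow> real \<Rightarrow> bool" where
  "trivalent_with E \<mu> \<longleftrightarrow>
     (\<exists>x. is_eigenvector (laplacian E) x \<mu> \<and> range (($) x) = {-1, 0, 1})"

definition bivalent :: "'a::finite set set \<Rightarrow> bool" where
  "bivalent E \<longleftrightarrow> (\<exists>\<mu>. bivalent_with E \<mu>)"

definition trivalent :: "'a::finite set set \<Rightarrow> bool" where
  "trivalent E \<longleftrightarrow> (\<exists>\<mu>. trivalent_with E \<mu>)"


text \<open>The basic graphs.  The vector is a function \<open>x\<close> on all of \<open>'a\<close>, of which only the values
  on \<open>V\<close> matter.  Vectors of disjoint pieces are thus combined by using the same \<open>x\<close>.\<close>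

definition basic_P2 :: "('a \<Rightarrow> real) \<Rightarrow> 'a set \<Rightarrow> 'a set set \<Rightarrow> bool" where
  "basic_P2 x V E \<longleftrightarrow>
     (\<exists>u v. u \<noteq> v \<and> V = {u, v} \<and> E = {{u, v}} \<and> x u = 1 \<and> x v = -1)"

definition basic_star :: "('a \<Rightarrow> real) \<Rightarrow> 'a set \<Rightarrow> 'a set set \<Rightarrow> bool" where
  "basic_star x V E \<longleftrightarrow>
     (\<exists>z P N k. k \<ge> (1::nat) \<and> finite P \<and> finite N \<and> card P = k \<and> card N = k \<and>
        P \<inter> N = {} \<and> z \<notin> P \<union> N \<and>
        V = insert z (P \<union> N) \<and> E = {{z, v} | v. v \<in> P \<union> N} \<and>
        x z = 0 \<and> (\<forall>v\<in>P. x v = 1) \<and> (\<forall>v\<in>N. x v = -1))"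

definition patterned_cycle ::
  "real list \<Rightarrow> ('a \<Rightarrow> real) \<Rightarrow> 'a set \<Rightarrow> 'a set set \<Rightarrow> bool" where
  "patterned_cycle p x V E \<longleftrightarrow>
     (\<exists>c k. k \<ge> 1 \<and> cycle_on c V E \<and> map x c = concat (replicate k p))"

abbreviation "basic_C4k \<equiv> patterned_cycle [1, 0, -1, 0]"
abbreviation "basic_C3k \<equiv> patterned_cycle [1, 0, -1]"
abbreviation "basic_C2k \<equiv> patterned_cycle [1, -1]"

text \<open>The basic graphs, classified by the eigenvalue that their vector affords.\<close>

inductive basic_graph :: "real \<Rightarrow> ('a \<Rightarrow> real) \<Rightarrow> 'a set \<Rightarrow> 'a set set \<Rightarrow> bool" where
  star: "basic_star x V E \<Longrightarrow> basic_graph 1 x V E"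
| P2:  "basic_P2 x V E \<Longrightarrow> basic_graph 2 x V E"
| C4k: "basic_C4k x V E \<Longrightarrow> basic_graph 2 x V E"
| C3k: "basic_C3k x V E \<Longrightarrow> basic_graph 3 x V E"
| C2k: "basic_C2k x V E \<Longrightarrow> basic_graph 4 x V E"

text \<open>Disjoint unions of graphs from the family \<open>B\<close> with equal links added.\<close>

inductive equal_linked ::
  "(('a \<Rightarrow> real) \<Rightarrow> 'a set \<Rightarrow> 'a set set \<Rightarrow> bool) \<Rightarrow>
   ('a \<Rightarrow> real) \<Rightarrow> 'a set \<Rightarrow> 'a set set \<Rightarrow> bool"
  for B x where
  piece: "B x V E \<Longrightarrow> equal_linked B x V E"
| union: "equal_linked B x V E \<Longrightarrow> equal_linked B x V' E' \<Longrightarrow> V \<inter> V' = {} \<Longrightarrow>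
    equal_linked B x (V \<union> V') (E \<union> E')"
| link: "equal_linked B x V E \<Longrightarrow> u \<in> V \<Longrightarrow> v \<in> V \<Longrightarrow> u \<noteq> v \<Longrightarrow> x u = x v \<Longrightarrow>
    equal_linked B x V (insert {u, v} E)"

text \<open>Graphs obtained from a graph in the family \<open>B\<close>, whose vector affords the eigenvalue \<open>\<mu>\<close>,
  by adding equal links and soft nodes.  Equal links may also go to further disjoint basic
  graphs; these must afford the same eigenvalue \<open>\<mu>\<close>, because otherwise the combined vector is
  not an eigenvector.  For \<open>\<mu> = 1\<close> and \<open>\<mu> = 3\<close> these are again stars and cycles
  \<open>C\<^sub>3\<^sub>k\<close>, respectively.  For \<open>\<mu> = 2\<close> they are cycles \<open>C\<^sub>4\<^sub>k\<close> and paths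
  \<open>P\<^sub>2\<close>, and the latter are indispensable: attaching a pendant path with two further vertices
  to each of two adjacent vertices of \<open>C\<^sub>4\<close> gives a trivalent graph that cannot be obtained
  without \<open>P\<^sub>2\<close>.\<close>

inductive obtained_from ::
  "(('a \<Rightarrow> real) \<Rightarrow> 'a set \<Rightarrow> 'a set set \<Rightarrow> bool) \<Rightarrow> real \<Rightarrow>
   ('a \<Rightarrow> real) \<Rightarrow> 'a set \<Rightarrow> 'a set set \<Rightarrow> bool"
  for B \<mu> x where
  start: "B x V E \<Longrightarrow> obtained_from B \<mu> x V E"
| join: "obtained_from B \<mu> x V E \<Longrightarrow> basic_graph \<mu> x V' E' \<Longrightarrow> V \<inter> V' = {} \<Longrightarrow>
    obtained_from B \<mu> x (V \<union> V') (E \<union> E')"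
| link: "obtained_from B \<mu> x V E \<Longrightarrow> u \<in> V \<Longrightarrow> v \<in> V \<Longrightarrow> u \<noteq> v \<Longrightarrow> x u = x v \<Longrightarrow>
    obtained_from B \<mu> x V (insert {u, v} E)"
| soft: "obtained_from B \<mu> x V E \<Longrightarrow> w \<notin> V \<Longrightarrow> x w = 0 \<Longrightarrow>
    S \<noteq> {} \<Longrightarrow> S \<subseteq> {v \<in> V. x v = 0} \<Longrightarrow>
    obtained_from B \<mu> x (insert w V) (E \<union> {{w, s} | s. s \<in> S})"

definition linked_P2_chains :: "'a set set \<Rightarrow> bool" where
  "linked_P2_chains E \<longleftrightarrow> (\<exists>x. equal_linked basic_P2 x UNIV E)"

definition obtained_from_stars :: "'a set set \<Rightarrow> bool" where
  "obtained_from_stars E \<longleftrightarrow> (\<exists>x. obtained_from basic_star 1 x UNIV E)"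

definition obtained_from_C4k :: "'a set set \<Rightarrow> bool" where
  "obtained_from_C4k E \<longleftrightarrow> (\<exists>x. obtained_from basic_C4k 2 x UNIV E)"

definition obtained_from_C3k :: "'a set set \<Rightarrow> bool" where
  "obtained_from_C3k E \<longleftrightarrow> (\<exists>x. obtained_from basic_C3k 3 x UNIV E)"

end

theory Submission
  imports Defs
begin

text \<open>Edges between equal values do not contribute to the Laplacian, so only the graph \<open>F\<close> of
  unequal edges matters.  A soft node has equally many neighbours of value \<open>1\<close> and \<open>-1\<close>; a
  vertex \<open>v\<close> of value \<open>\<plusminus>1\<close> with \<open>a\<close> soft neighbours and \<open>b\<close> neighbours of value \<open>- x v\<close>
  satisfies \<open>a + 2 * b = \<mu>\<close>.  In a unicyclic graph every nonempty subgraph of minimum degree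
  at least \<open>2\<close> is the cycle itself.  In the trivalent case, \<open>\<mu> = 1\<close> makes \<open>F\<close> a disjoint
  union of stars; for \<open>\<mu> = 2\<close> the edges at soft nodes form a subgraph of minimum degree
  \<open>2\<close>, hence the cycle, and the other unequal edges form copies of \<open>P\<^sub>2\<close>; for
  \<open>\<mu> \<ge> 3\<close> the graph \<open>F\<close> itself has minimum degree \<open>2\<close>, so it is the cycle and \<open>\<mu> = 3\<close>.
  The bivalent case is the same argument without soft nodes.\<close>

subsection \<open>Cycles and minimum degree\<close>

text \<open>Its cardinality is literally the diagonal entry of \<open>degree_matrix\<close>.\<close>

definition nbh :: "'a set set \<Rightarrow> 'a \<Rightarrow> 'a set" where
  "nbh E v = {w. {v, w} \<in> E}"

lemma nbh_sym: "w \<in> nbh E v \<longleftrightarrow> v \<in> nbh E w"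
  by (simp add: nbh_def insert_commute)

lemma simple_graph_subset: "simple_graph E \<Longrightarrow> F \<subseteq> E \<Longrightarrow> simple_graph F"
  by (auto simp: simple_graph_def)

lemma simple_graph_edgeE:
  assumes "simple_graph E" "e \<in> E"
  obtains u v where "e = {u, v}" "u \<noteq> v"
  using assms by (auto simp: simple_graph_def card_2_iff)

lemma simple_graph_edge_atE:
  assumes "simple_graph E" "e \<in> E" "v \<in> e"
  obtains w where "e = {v, w}" "w \<noteq> v"
  using assms by (elim simple_graph_edgeE) (auto simp: insert_commute)

lemma in_Union_iff_nbh:
  assumes "simple_graph E"
  shows "v \<in> \<Union>E \<longleftrightarrow> nbh E v \<noteq> {}"
proof
  assume "v \<in> \<Union>E"
  then obtain e where "e \<in> E" "v \<in> e" by auto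
  with assms show "nbh E v \<noteq> {}"
    by (elim simple_graph_edge_atE) (auto simp: nbh_def)
qed (auto simp: nbh_def)

text \<open>In a simple graph \<open>w \<mapsto> {v, w}\<close> is a bijection from neighbours to
  incident edges. It serves the double counting below and isolates the single edge at a
  leaf.\<close>

lemma card_incident:
  assumes "simple_graph E"
  shows "card {e \<in> E. v \<in> e} = card (nbh E v)"
proof -
  have "bij_betw (\<lambda>w. {v, w}) (nbh E v) {e \<in> E. v \<in> e}"
    unfolding bij_betw_def
  proof
    show "inj_on (\<lambda>w. {v, w}) (nbh E v)"
      by (auto simp: inj_on_def doubleton_eq_iff)
    show "(\<lambda>w. {v, w}) ` nbh E v = {e \<in> E. v \<in> e}"
      using assms by (auto simp: nbh_def elim: simple_graph_edge_atE)
  qed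
  then show ?thesis by (metis bij_betw_same_card)
qed

text \<open>Incidences are counted twice, by vertices and by edges; each edge has two ends.\<close>

lemma handshake:
  fixes E :: "'a::finite set set"
  assumes "simple_graph E"
  shows "(\<Sum>v\<in>\<Union>E. card (nbh E v)) = 2 * card E"
proof -
  have "(\<Sum>v\<in>\<Union>E. card (nbh E v)) = (\<Sum>v\<in>\<Union>E. card {e \<in> E. v \<in> e})"
    using assms by (simp add: card_incident)
  also have "\<dots> = (\<Sum>v\<in>\<Union>E. \<Sum>e\<in>{e \<in> E. v \<in> e}. 1)"
    by simp
  also have "\<dots> = (\<Sum>e\<in>E. \<Sum>v\<in>{v \<in> \<Union>E. v \<in> e}. 1)"
    by (rule sum.swap_restrict) auto
  also have "\<dots> = (\<Sum>e\<in>E. card e)"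
    by (intro sum.cong) (auto intro!: arg_cong[where f = card])
  also have "\<dots> = 2 * card E"
    using assms by (simp add: simple_graph_def)
  finally show ?thesis .
qed

section \<open>Neighbourhoods along a cycle given by a list\<close>

lemma Suc_mod_inject:
  "Suc i mod n = Suc j mod n \<longleftrightarrow> i mod n = j mod n" if "0 < n"
  using that by (auto simp: mod_Suc split: if_splits)

text \<open>The formula is centred at \<open>Suc i\<close>, so the predecessor needs no subtraction
  and all indices are read modulo \<open>n\<close>. The two neighbours differ because their indices
  differ by 2 and \<open>n\<close> is at least 3.\<close>

lemma nbh_cycle_edges:
  fixes i :: nat and c :: "'a list"
  defines "n \<equiv> length c"
  assumes "distinct c" "3 \<le> n"
  shows "nbh (cycle_edges c) (c ! (Suc i mod n)) = {c ! (i mod n), c ! (Suc (Suc i) mod n)}"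
    and "c ! (i mod n) \<noteq> c ! (Suc (Suc i) mod n)"
proof -
  have n: "0 < n" using assms(3) by linarith
  have eq: "c ! (a mod n) = c ! (b mod n) \<longleftrightarrow> a mod n = b mod n" for a b
    using assms n by (simp add: nth_eq_iff_index_eq)
  \<comment> \<open>Replacing \<open>j\<close> by \<open>j mod n\<close> lets \<open>eq\<close>
    compare any two vertices that occur.\<close>
  have edges: "cycle_edges c = {{c ! (j mod n), c ! (Suc j mod n)} | j. j < n}"
    unfolding cycle_edges_def n_def[symmetric] by (intro Collect_cong iff_exI) auto
  have mem: "{c ! (Suc i mod n), w} \<in> cycle_edges c \<longleftrightarrow>
      (\<exists>j<n. {c ! (Suc i mod n), w} = {c ! (j mod n), c ! (Suc j mod n)})" for w
    unfolding edges by auto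
  show "nbh (cycle_edges c) (c ! (Suc i mod n)) = {c ! (i mod n), c ! (Suc (Suc i) mod n)}"
  proof (intro set_eqI iffI)
    fix w assume "w \<in> nbh (cycle_edges c) (c ! (Suc i mod n))"
    then obtain j where "{c ! (Suc i mod n), w} = {c ! (j mod n), c ! (Suc j mod n)}"
      by (auto simp: nbh_def mem)
    then have "Suc i mod n = j mod n \<and> w = c ! (Suc j mod n) \<or>
        Suc i mod n = Suc j mod n \<and> w = c ! (j mod n)"
      by (simp add: doubleton_eq_iff eq)
    then show "w \<in> {c ! (i mod n), c ! (Suc (Suc i) mod n)}"
    proof (elim disjE conjE)
      assume "Suc i mod n = j mod n" "w = c ! (Suc j mod n)"
      then show ?thesis
        using mod_Suc_eq[of "Suc i" n] mod_Suc_eq[of j n] by simp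
    next
      assume "Suc i mod n = Suc j mod n" "w = c ! (j mod n)"
      then show ?thesis
        using n by (simp add: Suc_mod_inject)
    qed
  next
    fix w assume "w \<in> {c ! (i mod n), c ! (Suc (Suc i) mod n)}"
    then have "\<exists>j<n. {c ! (Suc i mod n), w} = {c ! (j mod n), c ! (Suc j mod n)}"
    proof (elim insertE emptyE)
      assume "w = c ! (i mod n)"
      then show ?thesis
        using n by (intro exI[of _ "i mod n"]) (auto simp: mod_Suc_eq)
    next
      assume "w = c ! (Suc (Suc i) mod n)"
      then show ?thesis
        using n by (intro exI[of _ "Suc i mod n"]) (auto simp: mod_Suc_eq)
    qed
    then show "w \<in> nbh (cycle_edges c) (c ! (Suc i mod n))"
      by (simp add: nbh_def mem)
  qed
  have "i mod n \<noteq> Suc (Suc i) mod n"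
    using assms(3) by (auto simp: mod_Suc split: if_splits)
  then show "c ! (i mod n) \<noteq> c ! (Suc (Suc i) mod n)"
    by (simp add: eq)
qed

lemma set_cycle_nthE:
  assumes "v \<in> set c"
  obtains i where "v = c ! (Suc i mod length c)"
proof -
  from assms obtain j where j: "j < length c" "v = c ! j"
    by (auto simp: in_set_conv_nth)
  \<comment> \<open>The witness \<open>j + length c - 1\<close> is the cyclic predecessor of
    \<open>j\<close>, also when \<open>j = 0\<close>.\<close>
  show ?thesis
  proof (rule that)
    have "Suc (j + length c - 1) = j + length c"
      using j by simp
    then show "v = c ! (Suc (j + length c - 1) mod length c)"
      using j by simp
  qed
qed

lemma card_nbh_cycle:
  assumes "cycle_on c V E" "v \<in> V"
  shows "card (nbh E v) = 2"
proof -
  obtain i where "v = c ! (Suc i mod length c)"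
    using assms by (auto simp: cycle_on_def elim: set_cycle_nthE)
  then show ?thesis
    using assms nbh_cycle_edges[of c i] by (simp add: cycle_on_def)
qed

lemma Union_cycle_edges: "\<Union>(cycle_edges c) = set c"
proof
  show "\<Union>(cycle_edges c) \<subseteq> set c"
    by (auto simp: cycle_edges_def intro!: nth_mem mod_less_divisor)
next
  show "set c \<subseteq> \<Union>(cycle_edges c)"
  proof
    fix v assume "v \<in> set c"
    then obtain i where "i < length c" "v = c ! i"
      by (auto simp: in_set_conv_nth)
    then show "v \<in> \<Union>(cycle_edges c)"
      unfolding cycle_edges_def by blast
  qed
qed

lemma simple_graph_cycle:
  assumes "cycle_on c V E"
  shows "simple_graph E"
proof -
  have "c ! i \<noteq> c ! (Suc i mod length c)" if "i < length c" for i
  proof -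
    have "Suc i mod length c < length c" "Suc i mod length c \<noteq> i"
      using that assms by (auto simp: cycle_on_def mod_Suc)
    then show ?thesis
      using that assms by (auto simp: cycle_on_def nth_eq_iff_index_eq)
  qed
  then show ?thesis
    using assms by (auto simp: simple_graph_def cycle_on_def cycle_edges_def card_2_iff)
qed

text \<open>A longest path cannot be extended at its first vertex, so that vertex has a second neighbour
  further along the path.\<close>
lemma ex_cycle_if_min_degree:
  fixes F :: "'a::finite set set"
  assumes "simple_graph F" "F \<noteq> {}"
    and deg: "\<And>v. v \<in> \<Union>F \<Longrightarrow> 2 \<le> card (nbh F v)"
  shows "\<exists>c V C. cycle_on c V C \<and> C \<subseteq> F"
proof -
  define path where "path p \<longleftrightarrow> distinct p \<and> 2 \<le> length p \<and>
    (\<forall>i. Suc i < length p \<longrightarrow> {p ! i, p ! Suc i} \<in> F)" for p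
  obtain u v where "{u, v} \<in> F" "u \<noteq> v"
    using assms by (metis simple_graph_edgeE ex_in_conv)
  then have "path [u, v]"
    by (auto simp: path_def)
  \<comment> \<open>A path repeats no vertex, so lengths are bounded and a longest path
    exists.\<close>
  moreover have "length p < Suc (card (UNIV :: 'a set))" if "path p" for p
    using that distinct_card[of p] card_mono[of UNIV "set p"] by (auto simp: path_def)
  ultimately obtain p where p: "path p" and maxp: "\<And>q. path q \<Longrightarrow> length q \<le> length p"
    using ex_has_greatest_nat[of path "[u, v]" length] by blast
  have "{p ! 0, p ! 1} \<in> F"
    using p by (auto simp: path_def)
  then have "2 \<le> card (nbh F (p ! 0))"
    by (intro deg) auto
  moreover have "card {p ! 1} = 1" by simp
  ultimately have "\<not> nbh F (p ! 0) \<subseteq> {p ! 1}"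
    using card_mono[of "{p ! 1}" "nbh F (p ! 0)"] by auto
  then obtain w where w: "{p ! 0, w} \<in> F" "w \<noteq> p ! 1"
    by (auto simp: nbh_def)
  have "w \<in> set p"
  proof (rule ccontr)
    assume "w \<notin> set p"
    then have "path (w # p)"
      using p w by (auto simp: path_def nth_Cons insert_commute split: nat.splits)
    from maxp[OF this] show False by simp
  qed
  then obtain j where j: "j < length p" "w = p ! j"
    by (auto simp: in_set_conv_nth)
  have "w \<noteq> p ! 0"
    using w assms(1) by (auto simp: simple_graph_def)
  \<comment> \<open>Index 0 is excluded because there are no loops, index 1 by the choice of
    \<open>w\<close>; hence the cycle obtained below has at least three vertices.\<close>
  with j w have "2 \<le> j"
    by (metis One_nat_def less_2_cases not_le)
  \<comment> \<open>The initial segment up to \<open>w\<close>, closed by the edge from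
    \<open>w\<close> back to \<open>p ! 0\<close>.\<close>
  define c where "c = take (Suc j) p"
  have len: "length c = Suc j"
    using j by (simp add: c_def)
  have "cycle_on c (set c) (cycle_edges c)"
    using p len \<open>2 \<le> j\<close> by (auto simp: cycle_on_def path_def c_def)
  moreover have "cycle_edges c \<subseteq> F"
  proof
    fix e assume "e \<in> cycle_edges c"
    then obtain i where i: "i \<le> j" "e = {c ! i, c ! (Suc i mod Suc j)}"
      by (auto simp: cycle_edges_def len less_Suc_eq_le)
    show "e \<in> F"
    proof (cases "i = j")
      case True
      then show ?thesis
        using i w j by (simp add: c_def insert_commute)
    next
      case False
      then have "Suc i < length p"
        using i j by simp
      then show ?thesis
        using i False p by (auto simp: c_def path_def)
    qed
  qed
  ultimately show ?thesis by blast
qed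

text \<open>Without a cycle some vertex has degree below 2. Since only vertices in
  \<open>\<Union>F\<close> are counted, it is a leaf, and deleting its edge loses one edge and at
  least one vertex.\<close>

lemma card_edges_acyclic:
  fixes F :: "'a::finite set set"
  assumes "simple_graph F" "F \<noteq> {}"
    and "\<nexists>c V C. cycle_on c V C \<and> C \<subseteq> F"
  shows "card F < card (\<Union>F)"
  using assms
proof (induction "card F" arbitrary: F rule: less_induct)
  case less
  then obtain v where v: "v \<in> \<Union>F" "card (nbh F v) < 2"
    by (metis ex_cycle_if_min_degree not_le)
  moreover have "nbh F v \<noteq> {}"
    using v(1) in_Union_iff_nbh[OF less.prems(1)] by simp
  ultimately have "card (nbh F v) = 1"
    by (metis One_nat_def card_gt_0_iff finite less_2_cases less_irrefl)
  then have "card {e \<in> F. v \<in> e} = 1"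
    using less.prems by (simp add: card_incident)
  then obtain e where e: "{e \<in> F. v \<in> e} = {e}"
    by (metis card_1_singletonE)
  then have "e \<in> F" "v \<in> e" by auto
  \<comment> \<open>The induction hypothesis requires a nonempty edge set, so a single edge is
    treated separately.\<close>
  show ?case
  proof (cases "F = {e}")
    case True
    then show ?thesis
      using less.prems by (simp add: simple_graph_def)
  next
    case False
    have "card (F - {e}) < card (\<Union>(F - {e}))"
    proof (rule less.hyps)
      show "card (F - {e}) < card F"
        using \<open>e \<in> F\<close> by (intro psubset_card_mono) auto
      show "simple_graph (F - {e})"
        using less.prems(1) by (auto intro: simple_graph_subset)
      show "F - {e} \<noteq> {}"
        using False \<open>e \<in> F\<close> by auto
      show "\<nexists>c V C. cycle_on c V C \<and> C \<subseteq> F - {e}"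
        using less.prems(3) by blast
    qed
    \<comment> \<open>The leaf \<open>v\<close> lies in no edge other than \<open>e\<close>.\<close>
    moreover have "card (\<Union>(F - {e})) < card (\<Union>F)"
      using e v by (intro psubset_card_mono) auto
    moreover have "card F = Suc (card (F - {e}))"
      using \<open>e \<in> F\<close> by (intro card.remove) auto
    ultimately show ?thesis by simp
  qed
qed

lemma nbh_mono: "E \<subseteq> F \<Longrightarrow> nbh E v \<subseteq> nbh F v"
  by (auto simp: nbh_def)

text \<open>Without one edge of its cycle the graph is a forest, so it has at most as many edges as vertices
  and is therefore 2-regular.  The edges off the cycle then have minimum degree 2 again and would
  contain a second cycle.\<close>
lemma min_degree_unicyclic:
  fixes F :: "'a::finite set set"
  assumes simple: "simple_graph F" and "F \<noteq> {}"
    and deg: "\<And>v. v \<in> \<Union>F \<Longrightarrow> 2 \<le> card (nbh F v)"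
    and unique: "\<And>c V C c' V' C'. cycle_on c V C \<Longrightarrow> C \<subseteq> F \<Longrightarrow>
      cycle_on c' V' C' \<Longrightarrow> C' \<subseteq> F \<Longrightarrow> C = C'"
  shows "\<exists>c. cycle_on c (\<Union>F) F"
proof -
  obtain c V C where c: "cycle_on c V C" "C \<subseteq> F"
    using ex_cycle_if_min_degree[OF simple \<open>F \<noteq> {}\<close> deg] by auto
  then have V: "V = \<Union>C"
    by (auto simp: cycle_on_def Union_cycle_edges)
  have "V \<noteq> {}"
    using c by (auto simp: cycle_on_def)
  with V have "C \<noteq> {}"
    by auto
  then obtain e where "e \<in> C" by auto
  have "card F \<le> card (\<Union>F)"
  proof (cases "F = {e}")
    case True
    then show ?thesis
      using simple by (simp add: simple_graph_def)
  next
    case False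
    have "card (F - {e}) < card (\<Union>(F - {e}))"
    proof (rule card_edges_acyclic)
      show "simple_graph (F - {e})"
        using simple by (auto intro: simple_graph_subset)
      show "F - {e} \<noteq> {}"
        using False \<open>F \<noteq> {}\<close> by auto
      show "\<nexists>c V C. cycle_on c V C \<and> C \<subseteq> F - {e}"
        using unique[OF c] \<open>e \<in> C\<close> by blast
    qed
    moreover have "card (\<Union>(F - {e})) \<le> card (\<Union>F)"
      by (intro card_mono) auto
    moreover have "card F = Suc (card (F - {e}))"
      using \<open>e \<in> C\<close> c by (intro card.remove) auto
    ultimately show ?thesis by simp
  qed
  \<comment> \<open>The average degree is thus at most 2, so a minimum degree of 2 forces equality
    at every vertex.\<close>
  then have "(\<Sum>v\<in>\<Union>F. card (nbh F v)) \<le> (\<Sum>v\<in>\<Union>F. 2)"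
    using handshake[OF simple] by simp
  have two: "card (nbh F v) = 2" if "v \<in> \<Union>F" for v
  proof (rule ccontr)
    assume "card (nbh F v) \<noteq> 2"
    then have "2 < card (nbh F v)"
      using deg[OF that] by simp
    then have "(\<Sum>v\<in>\<Union>F. 2) < (\<Sum>v\<in>\<Union>F. card (nbh F v))"
      using deg that by (intro sum_strict_mono_ex1) auto
    then show False
      using \<open>(\<Sum>v\<in>\<Union>F. card (nbh F v)) \<le> (\<Sum>v\<in>\<Union>F. 2)\<close> by simp
  qed
  \<comment> \<open>One neighbourhood contains the other and both have two elements.\<close>
  have on_cycle: "nbh C v = nbh F v" if "v \<in> V" for v
    using that c two[of v] card_nbh_cycle[OF c(1) that] V
    by (intro card_subset_eq nbh_mono) auto
  have "F - C = {}"
  proof (rule ccontr)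
    assume "F - C \<noteq> {}"
    have "\<exists>c V D. cycle_on c V D \<and> D \<subseteq> F - C"
    proof (rule ex_cycle_if_min_degree)
      show "simple_graph (F - C)"
        using simple by (auto intro: simple_graph_subset)
      show "F - C \<noteq> {}" by fact
      fix v assume "v \<in> \<Union>(F - C)"
      then obtain w where w: "{v, w} \<in> F" "{v, w} \<notin> C"
        using simple by (auto elim: simple_graph_edge_atE)
      \<comment> \<open>At a vertex of the cycle every edge of \<open>F\<close> belongs to the
        cycle. So \<open>v\<close> is off the cycle and loses no edge when \<open>C\<close> is
        removed.\<close>
      then have "v \<notin> V"
        using on_cycle[of v] by (auto simp: nbh_def)
      then have "nbh (F - C) v = nbh F v"
        using V by (auto simp: nbh_def)
      then show "2 \<le> card (nbh (F - C) v)"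
        using two[of v] w(1) by (metis UnionI insertI1 order_refl)
    qed
    then obtain c' V' D where D: "cycle_on c' V' D" "D \<subseteq> F - C" by blast
    then have "D = C"
      using unique c by blast
    with D \<open>C \<noteq> {}\<close> show False by auto
  qed
  then have "C = F"
    using c by auto
  with c V show ?thesis by auto
qed

subsection \<open>Vectors afforded by the basic graphs\<close>

text \<open>The Laplacian at a vertex, written as a sum of differences so that edges between equal
  values visibly contribute nothing.\<close>

definition lap :: "'a set set \<Rightarrow> ('a \<Rightarrow> real) \<Rightarrow> 'a \<Rightarrow> real" where
  "lap E x v = (\<Sum>w\<in>nbh E v. x v - x w)"

text \<open>The eigenvalue equation is local to \<open>V\<close>, which allows pieces to be combined
  over one function \<open>x\<close>. That \<open>x\<close> does not vanish is tracked separately,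
  through its set of values.\<close>

definition affords :: "real \<Rightarrow> ('a \<Rightarrow> real) \<Rightarrow> 'a set \<Rightarrow> 'a set set \<Rightarrow> bool" where
  "affords \<mu> x V E \<longleftrightarrow> simple_graph E \<and> \<Union>E \<subseteq> V \<and> (\<forall>v\<in>V. lap E x v = \<mu> * x v)"

lemma laplacian_mult_vec:
  assumes "simple_graph E"
  shows "(laplacian E *v x) $ v = lap E (($) x) v"
proof -
  have "(laplacian E *v x) $ v =
      (\<Sum>j\<in>UNIV. (if j = v then real (card (nbh E v)) * x $ v else 0) -
        (if j \<in> nbh E v then x $ j else 0))"
    unfolding laplacian_def degree_matrix_def adjacency_matrix_def matrix_vector_mult_def
    by (auto simp: nbh_def algebra_simps intro!: sum.cong)
  also have "\<dots> = real (card (nbh E v)) * x $ v - (\<Sum>w\<in>nbh E v. x $ w)"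
    by (simp add: sum_subtractf sum.If_cases)
  also have "\<dots> = lap E (($) x) v"
    by (simp add: lap_def sum_subtractf)
  finally show ?thesis .
qed

text \<open>This translates between vectors and functions; a nonzero value in \<open>R\<close>
  guarantees that the vector is nonzero.\<close>

lemma ex_eigenvector_iff_affords:
  assumes "simple_graph E" and "\<exists>r\<in>R. r \<noteq> 0"
  shows "(\<exists>x. is_eigenvector (laplacian E) x \<mu> \<and> range (($) x) = R) \<longleftrightarrow>
    (\<exists>x. affords \<mu> x UNIV E \<and> range x = R)"
proof
  assume "\<exists>x. is_eigenvector (laplacian E) x \<mu> \<and> range (($) x) = R"
  then obtain x where x: "laplacian E *v x = \<mu> *\<^sub>R x" "range (($) x) = R"
    by (auto simp: is_eigenvector_def)
  then have "lap E (($) x) v = \<mu> * x $ v" for v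
    using laplacian_mult_vec[OF assms(1), of x v] by simp
  then show "\<exists>x. affords \<mu> x UNIV E \<and> range x = R"
    using x assms by (auto simp: affords_def)
next
  assume "\<exists>x. affords \<mu> x UNIV E \<and> range x = R"
  then obtain x where x: "affords \<mu> x UNIV E" "range x = R"
    by auto
  define y where "y = (\<chi> v. x v)"
  have y: "($) y = x"
    by (simp add: y_def fun_eq_iff)
  have "laplacian E *v y = \<mu> *\<^sub>R y"
    using x assms(1) by (simp add: vec_eq_iff laplacian_mult_vec y affords_def)
  moreover have "y \<noteq> 0"
    using assms(2) x(2) y by auto
  ultimately show "\<exists>x. is_eigenvector (laplacian E) x \<mu> \<and> range (($) x) = R"
    using x(2) y by (auto simp: is_eigenvector_def)
qed

lemma lap_unequal:
  fixes E :: "'a::finite set set"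
  shows "lap E x v = (\<Sum>w | w \<in> nbh E v \<and> x w \<noteq> x v. x v - x w)"
  unfolding lap_def by (rule sum.mono_neutral_right) auto

text \<open>Every additional edge joins equal values, so the Laplacian does not change. At an added
  vertex both sides of the equation are 0. Equal links and soft nodes are both instances.\<close>

lemma affords_equal_edges:
  fixes E :: "'a::finite set set"
  assumes "affords \<mu> x V E" and "E \<subseteq> E'" "simple_graph E'" "V \<subseteq> V'" "\<Union>E' \<subseteq> V'"
    and "\<And>v w. {v, w} \<in> E' \<Longrightarrow> x v \<noteq> x w \<Longrightarrow> {v, w} \<in> E"
    and "\<And>v. v \<in> V' - V \<Longrightarrow> x v = 0"
  shows "affords \<mu> x V' E'"
proof -
  have "lap E' x v = lap E x v" for v
    using assms(2,6) unfolding lap_unequal by (intro sum.cong) (auto simp: nbh_def)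
  moreover have "lap E x v = 0" if "v \<notin> V" for v
  proof -
    have "nbh E v = {}"
      using that assms(1) by (auto simp: nbh_def affords_def)
    then show ?thesis
      by (simp add: lap_def)
  qed
  ultimately show ?thesis
    using assms by (auto simp: affords_def)
qed

lemma affords_union:
  assumes "affords \<mu> x V E" "affords \<mu> x V' E'" "V \<inter> V' = {}"
  shows "affords \<mu> x (V \<union> V') (E \<union> E')"
proof -
  have "lap (E \<union> E') x v = lap E x v" if "v \<in> V" for v
  proof -
    have "nbh (E \<union> E') v = nbh E v"
      using that assms by (auto simp: affords_def nbh_def)
    then show ?thesis by (simp add: lap_def)
  qed
  moreover have "lap (E \<union> E') x v = lap E' x v" if "v \<in> V'" for v
  proof -
    have "nbh (E \<union> E') v = nbh E' v"
      using that assms by (auto simp: affords_def nbh_def)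
    then show ?thesis by (simp add: lap_def)
  qed
  ultimately show ?thesis
    using assms by (auto simp: affords_def simple_graph_def)
qed

lemma affords_link:
  fixes E :: "'a::finite set set"
  assumes "affords \<mu> x V E" "u \<in> V" "v \<in> V" "u \<noteq> v" "x u = x v"
  shows "affords \<mu> x V (insert {u, v} E)"
  by (rule affords_equal_edges[OF assms(1)])
    (use assms in \<open>auto simp: affords_def simple_graph_def doubleton_eq_iff\<close>)

lemma affords_soft:
  fixes E :: "'a::finite set set"
  assumes "affords \<mu> x V E" "w \<notin> V" "x w = 0" "S \<subseteq> {v \<in> V. x v = 0}"
  shows "affords \<mu> x (insert w V) (E \<union> {{w, s} | s. s \<in> S})"
proof (rule affords_equal_edges[OF assms(1)])
  show "simple_graph (E \<union> {{w, s} | s. s \<in> S})"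
    using assms by (auto simp: affords_def simple_graph_def card_2_iff) blast
qed (use assms in \<open>auto simp: affords_def doubleton_eq_iff\<close>)

section \<open>The eigenvalue equation for each basic graph\<close>

lemma affords_star:
  assumes "basic_star x V E"
  shows "affords 1 x V E" and "x ` V = {-1, 0, 1}"
proof -
  obtain z P N k where s: "k \<ge> (1::nat)" "finite P" "finite N" "card P = k" "card N = k"
      "P \<inter> N = {}" "z \<notin> P \<union> N" "V = insert z (P \<union> N)" "E = {{z, v} | v. v \<in> P \<union> N}"
      "x z = 0" "\<forall>v\<in>P. x v = 1" "\<forall>v\<in>N. x v = -1"
    using assms unfolding basic_star_def by (elim exE conjE) (rule that)
  have "P \<noteq> {}" "N \<noteq> {}"
    using s by auto
  then have "x ` P = {1}" "x ` N = {-1}"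
    using s by auto
  then show "x ` V = {-1, 0, 1}"
    using s by (auto simp: image_Un)
  \<comment> \<open>At the centre the equally many values 1 and -1 cancel; at a leaf the only
    neighbour is soft, which gives eigenvalue 1.\<close>
  have "nbh E z = P \<union> N"
    using s by (auto simp: nbh_def doubleton_eq_iff)
  then have "lap E x z = (\<Sum>w\<in>P \<union> N. - x w)"
    using s by (simp add: lap_def)
  also have "\<dots> = (\<Sum>w\<in>P. - x w) + (\<Sum>w\<in>N. - x w)"
    using s by (intro sum.union_disjoint) auto
  also have "\<dots> = 0"
    using s by simp
  finally have "lap E x z = 0" .
  moreover have "lap E x v = x v" if "v \<in> P \<union> N" for v
  proof -
    have "nbh E v = {z}"
      using that s by (auto simp: nbh_def doubleton_eq_iff)
    then show ?thesis
      using s by (simp add: lap_def)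
  qed
  moreover have "simple_graph E"
    using s by (auto simp: simple_graph_def card_2_iff)
  ultimately show "affords 1 x V E"
    using s by (auto simp: affords_def)
qed

lemma affords_P2:
  assumes "basic_P2 x V E"
  shows "affords 2 x V E" and "x ` V = {-1, 1}"
proof -
  obtain u v where uv: "u \<noteq> v" "V = {u, v}" "E = {{u, v}}" "x u = 1" "x v = -1"
    using assms unfolding basic_P2_def by metis
  then show "x ` V = {-1, 1}" by auto
  have "nbh E u = {v}" "nbh E v = {u}"
    using uv by (auto simp: nbh_def doubleton_eq_iff)
  then show "affords 2 x V E"
    using uv by (auto simp: affords_def simple_graph_def lap_def)
qed

text \<open>On a cycle the Laplacian is the negative second difference of the values in cyclic
  order.\<close>

lemma affords_cycle:
  assumes "cycle_on c V E"
    and "\<And>i. 2 * x (c ! (Suc i mod length c)) - x (c ! (i mod length c)) -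
      x (c ! (Suc (Suc i) mod length c)) = \<mu> * x (c ! (Suc i mod length c))"
  shows "affords \<mu> x V E"
proof -
  have "lap E x v = \<mu> * x v" if v: "v \<in> V" for v
  proof -
    obtain i where i: "v = c ! (Suc i mod length c)"
      using assms v by (auto simp: cycle_on_def elim: set_cycle_nthE)
    then show ?thesis
      using assms(1) assms(2)[of i] nbh_cycle_edges[of c i] by (simp add: cycle_on_def lap_def)
  qed
  then show ?thesis
    using assms simple_graph_cycle[of c V E] by (auto simp: affords_def cycle_on_def Union_cycle_edges)
qed

section \<open>Periodic values along a cycle\<close>

lemma length_concat_replicate: "length (concat (replicate k p)) = k * length p"
  by (induction k) auto

lemma nth_concat_replicate:
  "i < k * length p \<Longrightarrow> concat (replicate k p) ! i = p ! (i mod length p)"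
  by (induction k arbitrary: i) (auto simp: nth_append le_mod_geq)

text \<open>The length of \<open>p\<close> divides that of \<open>c\<close>, so the values stay
  periodic across the point where the cycle closes, and \<open>k\<close> disappears from the index
  arithmetic.\<close>

lemma pattern_nth:
  assumes "map x c = concat (replicate k p)" "c \<noteq> []"
  shows "x (c ! (i mod length c)) = p ! (i mod length p)"
proof -
  have len: "length c = k * length p"
    using assms by (metis length_map length_concat_replicate)
  have "i mod length c < length c"
    using assms by simp
  then have "x (c ! (i mod length c)) = concat (replicate k p) ! (i mod length c)"
    using assms by (metis nth_map)
  also have "\<dots> = p ! (i mod length c mod length p)"
    using \<open>i mod length c < length c\<close> len by (intro nth_concat_replicate) simp
  also have "i mod length c mod length p = i mod length p"
    using len by (simp add: mod_mod_cancel)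
  finally show ?thesis .
qed

lemma patternI:
  assumes "\<And>i. x (c ! (i mod length c)) = p ! (i mod length p)" "length c = k * length p"
  shows "map x c = concat (replicate k p)"
proof (rule nth_equalityI)
  show "length (map x c) = length (concat (replicate k p))"
    using assms by (simp add: length_concat_replicate)
  fix i assume "i < length (map x c)"
  then show "map x c ! i = concat (replicate k p) ! i"
    using assms(2) assms(1)[of i] by (simp add: nth_concat_replicate)
qed

lemma patterned_cycle_image:
  assumes "patterned_cycle p x V E"
  shows "x ` V = set p"
proof -
  obtain c k where c: "k \<ge> 1" "cycle_on c V E" "map x c = concat (replicate k p)"
    using assms by (auto simp: patterned_cycle_def)
  then have "x ` V = set (concat (replicate k p))"
    by (metis cycle_on_def set_map)
  then show ?thesis
    using c by auto
qed

text \<open>By periodicity the equation needs checking only on one period of the pattern.\<close>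

lemma affords_patterned_cycle:
  assumes "patterned_cycle p x V E"
    and "\<And>i. 2 * p ! (Suc i mod length p) - p ! (i mod length p) - p ! (Suc (Suc i) mod length p)
      = \<mu> * p ! (Suc i mod length p)"
  shows "affords \<mu> x V E"
proof -
  obtain c k where c: "cycle_on c V E" "map x c = concat (replicate k p)"
    using assms by (auto simp: patterned_cycle_def)
  then have "c \<noteq> []"
    by (auto simp: cycle_on_def)
  show ?thesis
    using c(1) by (rule affords_cycle)
      (simp only: pattern_nth[OF c(2) \<open>c \<noteq> []\<close>] assms(2))
qed

lemma affords_C4k: "basic_C4k x V E \<Longrightarrow> affords 2 x V E"
proof (rule affords_patterned_cycle)
  fix i :: nat
  have "i mod 4 = 0 \<or> i mod 4 = 1 \<or> i mod 4 = 2 \<or> i mod 4 = 3"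
    by linarith
  then show "2 * [1, 0, - 1, 0] ! (Suc i mod length [1, 0, - 1, 0 :: real]) -
      [1, 0, - 1, 0] ! (i mod length [1, 0, - 1, 0 :: real]) -
      [1, 0, - 1, 0] ! (Suc (Suc i) mod length [1, 0, - 1, 0 :: real]) =
      2 * [1, 0, - 1, 0 :: real] ! (Suc i mod length [1, 0, - 1, 0 :: real])"
    by (auto simp: mod_Suc)
qed

lemma affords_C3k: "basic_C3k x V E \<Longrightarrow> affords 3 x V E"
proof (rule affords_patterned_cycle)
  fix i :: nat
  have "i mod 3 = 0 \<or> i mod 3 = 1 \<or> i mod 3 = 2"
    by linarith
  then show "2 * [1, 0, - 1] ! (Suc i mod length [1, 0, - 1 :: real]) -
      [1, 0, - 1] ! (i mod length [1, 0, - 1 :: real]) -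
      [1, 0, - 1] ! (Suc (Suc i) mod length [1, 0, - 1 :: real]) =
      3 * [1, 0, - 1 :: real] ! (Suc i mod length [1, 0, - 1 :: real])"
    by (auto simp: mod_Suc)
qed

lemma affords_C2k: "basic_C2k x V E \<Longrightarrow> affords 4 x V E"
proof (rule affords_patterned_cycle)
  fix i :: nat
  have "i mod Suc (Suc 0) = 0 \<or> i mod Suc (Suc 0) = Suc 0"
    using mod_less_divisor[OF zero_less_Suc, of i "Suc 0"] by linarith
  then show "2 * [1, - 1] ! (Suc i mod length [1, - 1 :: real]) -
      [1, - 1] ! (i mod length [1, - 1 :: real]) -
      [1, - 1] ! (Suc (Suc i) mod length [1, - 1 :: real]) =
      4 * [1, - 1 :: real] ! (Suc i mod length [1, - 1 :: real])"
    by (auto simp: mod_Suc)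
qed

lemma affords_basic_graph:
  assumes "basic_graph \<mu> x V E"
  shows "affords \<mu> x V E" and "x ` V \<subseteq> {-1, 0, 1}"
  using assms
  by (cases; simp add: affords_star affords_P2 affords_C4k affords_C3k affords_C2k
      patterned_cycle_image)+

section \<open>Preservation of the eigenvalue equation by the constructions\<close>

lemma affords_equal_linked_P2:
  fixes x :: "'a::finite \<Rightarrow> real"
  assumes "equal_linked basic_P2 x V E"
  shows "affords 2 x V E \<and> x ` V = {-1, 1}"
  using assms
proof induction
  case (link V E u v)
  then show ?case by (simp add: affords_link)
qed (simp_all add: affords_P2 affords_union image_Un)

text \<open>Every constructor preserves the equation, and the initial graph already shows all three
  values, so later pieces and soft nodes add no new value.\<close>

lemma affords_obtained_from:
  fixes x :: "'a::finite \<Rightarrow> real"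
  assumes "obtained_from B \<mu> x V E"
    and "\<And>V E. B x V E \<Longrightarrow> affords \<mu> x V E \<and> x ` V = {-1, 0, 1}"
  shows "affords \<mu> x V E \<and> x ` V = {-1, 0, 1}"
  using assms(1)
proof induction
  case (start V E)
  then show ?case by (rule assms(2))
next
  case (join V E V' E')
  then show ?case
    using affords_basic_graph[of \<mu> x V' E'] by (auto simp: affords_union image_Un)
next
  case (link V E u v)
  then show ?case by (simp add: affords_link)
next
  case (soft V E w S)
  then have "affords \<mu> x (insert w V) (E \<union> {{w, s} | s. s \<in> S})"
    by (intro affords_soft) auto
  then show ?case
    using soft by (simp add: insert_absorb)
qed

lemma ex_map_distinct:
  assumes "distinct c" "length ys = length c"
  shows "\<exists>x. map x c = ys"
proof
  show "map (\<lambda>v. ys ! (THE i. i < length c \<and> c ! i = v)) c = ys"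
  proof (rule nth_equalityI)
    fix i assume "i < length (map (\<lambda>v. ys ! (THE i. i < length c \<and> c ! i = v)) c)"
    then have "(THE j. j < length c \<and> c ! j = c ! i) = i"
      using assms by (intro the_equality) (auto simp: nth_eq_iff_index_eq)
    then show "map (\<lambda>v. ys ! (THE i. i < length c \<and> c ! i = v)) c ! i = ys ! i"
      using \<open>i < _\<close> by simp
  qed (use assms in simp)
qed

text \<open>\<open>even_cycle\<close> carries no vector, so the alternating one is constructed here
  from the list of vertices.\<close>

lemma even_cycle_imp_affords:
  assumes "even_cycle E"
  shows "\<exists>x. affords 4 x UNIV E \<and> range x = {-1, 1}"
proof -
  obtain c k where c: "cycle_on c UNIV E" "length c = 2 * k"
    using assms by (auto simp: even_cycle_def)
  then obtain x where "map x c = concat (replicate k [1, -1 :: real])"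
    using ex_map_distinct[of c "concat (replicate k [1, -1 :: real])"]
    by (auto simp: cycle_on_def length_concat_replicate)
  moreover have "k \<ge> 1"
    using c by (auto simp: cycle_on_def)
  ultimately have "basic_C2k x UNIV E"
    using c by (auto simp: patterned_cycle_def)
  then have "affords 4 x UNIV E" "range x = {-1, 1}"
    using affords_C2k patterned_cycle_image[of "[1, -1]" x UNIV E] by auto
  then show ?thesis by blast
qed

subsection \<open>Assembling a graph from its unequal edges\<close>

abbreviation lnbh :: "'a set set \<Rightarrow> ('a \<Rightarrow> real) \<Rightarrow> 'a \<Rightarrow> real \<Rightarrow> 'a set" where
  "lnbh E x v r \<equiv> {w \<in> nbh E v. x w = r}"

definition unequal_edges :: "('a \<Rightarrow> real) \<Rightarrow> 'a set set \<Rightarrow> 'a set set" where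
  "unequal_edges x E = {e \<in> E. \<exists>u\<in>e. \<exists>v\<in>e. x u \<noteq> x v}"

lemma nbh_unequal_edges: "nbh (unequal_edges x E) v = {w \<in> nbh E v. x w \<noteq> x v}"
  by (auto simp: nbh_def unequal_edges_def)

text \<open>A walk from \<open>a\<close> to \<open>b\<close> must contain an edge that leaves
  \<open>V\<close>.\<close>

lemma connected_graph_crossing:
  assumes "connected_graph E" "a \<in> V" "b \<notin> V"
  obtains u w where "{u, w} \<in> E" "u \<in> V" "w \<notin> V"
proof -
  have "(a, b) \<in> {(a, b). {a, b} \<in> E}\<^sup>*"
    using assms by (simp add: connected_graph_def)
  then have "b \<notin> V \<longrightarrow> (\<exists>u w. {u, w} \<in> E \<and> u \<in> V \<and> w \<notin> V)"
    by (induction rule: rtrancl_induct) (use assms(2) in auto)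
  then show ?thesis
    using assms(3) that by blast
qed

text \<open>The neighbours are grouped by value; those of value \<open>r\<close> contribute
  \<open>x v - r\<close> each.\<close>

lemma lap_count:
  fixes E :: "'a::finite set set"
  assumes "range x \<subseteq> {-1, 0, 1}"
  shows "lap E x v = (x v + 1) * card (lnbh E x v (-1)) + x v * card (lnbh E x v 0) +
    (x v - 1) * card (lnbh E x v 1)"
proof -
  have vals: "x w = -1 \<or> x w = 0 \<or> x w = 1" for w
    using assms by auto
  have "lap E x v = (\<Sum>w\<in>lnbh E x v (-1) \<union> (lnbh E x v 0 \<union> lnbh E x v 1). x v - x w)"
    unfolding lap_def using vals by (intro sum.cong) auto
  also have "\<dots> = (\<Sum>w\<in>lnbh E x v (-1). x v - x w) + ((\<Sum>w\<in>lnbh E x v 0. x v - x w) +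
      (\<Sum>w\<in>lnbh E x v 1. x v - x w))"
    by (subst sum.union_disjoint; (subst sum.union_disjoint)?; auto)
  finally show ?thesis
    by (simp add: algebra_simps)
qed

section \<open>Adding sets of equal links and families of disjoint pieces\<close>

lemma equal_linked_link_set:
  fixes D :: "'a::finite set set"
  assumes "equal_linked B x V E" "simple_graph D" "\<Union>D \<subseteq> V"
    and "\<And>u v. {u, v} \<in> D \<Longrightarrow> x u = x v"
  shows "equal_linked B x V (E \<union> D)"
proof -
  have "finite D" by simp
  then show ?thesis
    using assms(2-)
  proof (induction D)
    case empty
    then show ?case using assms(1) by simp
  next
    case (insert e D)
    then obtain u v where uv: "e = {u, v}" "u \<noteq> v"
      by (meson insertI1 simple_graph_edgeE)
    have "equal_linked B x V (E \<union> D)"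
      using insert.prems by (intro insert.IH) (auto simp: simple_graph_def)
    then have "equal_linked B x V (insert {u, v} (E \<union> D))"
      using uv insert.prems by (intro equal_linked.link) auto
    then show ?case
      using uv by simp
  qed
qed

lemma obtained_from_link_set:
  fixes D :: "'a::finite set set"
  assumes "obtained_from B \<mu> x V E" "simple_graph D" "\<Union>D \<subseteq> V"
    and "\<And>u v. {u, v} \<in> D \<Longrightarrow> x u = x v"
  shows "obtained_from B \<mu> x V (E \<union> D)"
proof -
  have "finite D" by simp
  then show ?thesis
    using assms(2-)
  proof (induction D)
    case empty
    then show ?case using assms(1) by simp
  next
    case (insert e D)
    then obtain u v where uv: "e = {u, v}" "u \<noteq> v"
      by (meson insertI1 simple_graph_edgeE)
    have "obtained_from B \<mu> x V (E \<union> D)"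
      using insert.prems by (intro insert.IH) (auto simp: simple_graph_def)
    then have "obtained_from B \<mu> x V (insert {u, v} (E \<union> D))"
      using uv insert.prems by (intro obtained_from.link) auto
    then show ?case
      using uv by simp
  qed
qed

text \<open>The index set is nonempty because \<open>equal_linked\<close> does not start from an
  empty graph.\<close>

lemma equal_linked_family:
  assumes "finite I" "I \<noteq> {}"
    and "\<And>i. i \<in> I \<Longrightarrow> B x (W i) (D i)"
    and "disjoint_family_on W I"
  shows "equal_linked B x (\<Union>i\<in>I. W i) (\<Union>i\<in>I. D i)"
  using assms
proof (induction I rule: finite_ne_induct)
  case (singleton i)
  then show ?case by (auto intro: equal_linked.piece)
next
  case (insert i I)
  have "equal_linked B x (\<Union>i\<in>I. W i) (\<Union>i\<in>I. D i)"
    using insert.prems by (intro insert.IH) (auto simp: disjoint_family_on_def)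
  moreover have "equal_linked B x (W i) (D i)"
    using insert.prems by (auto intro: equal_linked.piece)
  moreover have "W i \<inter> (\<Union>i\<in>I. W i) = {}"
    using insert.prems(2) insert.hyps by (fastforce simp: disjoint_family_on_def)
  ultimately show ?case
    by (simp add: equal_linked.union)
qed

lemma obtained_from_family:
  assumes "finite I" "obtained_from B \<mu> x V E"
    and "\<And>i. i \<in> I \<Longrightarrow> basic_graph \<mu> x (W i) (D i)"
    and "disjoint_family_on W I" "\<And>i. i \<in> I \<Longrightarrow> V \<inter> W i = {}"
  shows "obtained_from B \<mu> x (V \<union> (\<Union>i\<in>I. W i)) (E \<union> (\<Union>i\<in>I. D i))"
  using assms
proof (induction I)
  case (insert i I)
  have "obtained_from B \<mu> x (V \<union> (\<Union>i\<in>I. W i)) (E \<union> (\<Union>i\<in>I. D i))"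
    using insert.prems by (intro insert.IH) (auto simp: disjoint_family_on_def)
  moreover have "basic_graph \<mu> x (W i) (D i)"
    using insert.prems by auto
  moreover have "W i \<inter> (\<Union>i\<in>I. W i) = {}"
    using insert.prems(3) insert.hyps by (fastforce simp: disjoint_family_on_def)
  then have "(V \<union> (\<Union>i\<in>I. W i)) \<inter> W i = {}"
    using insert.prems(4) by auto
  ultimately have "obtained_from B \<mu> x ((V \<union> (\<Union>i\<in>I. W i)) \<union> W i) ((E \<union> (\<Union>i\<in>I. D i)) \<union> D i)"
    by (rule obtained_from.join)
  then show ?case
    by (simp add: Un_ac)
qed simp

text \<open>While a vertex is missing, connectedness supplies an edge leaving \<open>V\<close>, and
  the hypotheses make both its ends soft; so \<open>V\<close> can grow by one soft node.
  \<open>D'\<close> collects the edges used, all of them between equal values.\<close>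

lemma obtained_from_soft_closure:
  fixes E :: "'a::finite set set"
  assumes "obtained_from B \<mu> x V D" "connected_graph E" "V \<noteq> {}"
    and "\<And>v. v \<notin> V \<Longrightarrow> x v = 0" "\<And>v w. {v, w} \<in> E \<Longrightarrow> w \<notin> V \<Longrightarrow> x v = 0"
  shows "\<exists>D'. obtained_from B \<mu> x UNIV (D \<union> D') \<and> D' \<subseteq> E - unequal_edges x E"
  using assms
proof (induction "card (- V)" arbitrary: V D rule: less_induct)
  case less
  show ?case
  proof (cases "V = UNIV")
    case True
    then show ?thesis
      using less.prems(1) by (intro exI[of _ "{}"]) auto
  next
    case False
    then obtain s w where sw: "{s, w} \<in> E" "s \<in> V" "w \<notin> V"
      using less.prems(2,3) by (metis UNIV_eq_I ex_in_conv connected_graph_crossing)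
    then have zero: "x s = 0" "x w = 0"
      using less.prems(4,5) by auto
    \<comment> \<open>One edge at \<open>w\<close> suffices here; its other edges join soft vertices
      and can follow as equal links.\<close>
    have "obtained_from B \<mu> x (insert w V) (D \<union> {{w, t} | t. t \<in> {s}})"
      using less.prems(1) sw zero by (intro obtained_from.soft) auto
    then have step: "obtained_from B \<mu> x (insert w V) (D \<union> {{w, s}})"
      by simp
    have "\<exists>D'. obtained_from B \<mu> x UNIV (D \<union> {{w, s}} \<union> D') \<and> D' \<subseteq> E - unequal_edges x E"
    proof (rule less.hyps[OF _ step less.prems(2)])
      show "card (- insert w V) < card (- V)"
        using sw by (intro psubset_card_mono) auto
    qed (use less.prems in auto)
    then obtain D' where D': "obtained_from B \<mu> x UNIV (D \<union> {{w, s}} \<union> D')"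
        "D' \<subseteq> E - unequal_edges x E"
      by blast
    show ?thesis
      by (intro exI[of _ "insert {w, s} D'"])
        (use D' sw zero in \<open>auto simp: unequal_edges_def insert_commute\<close>)
  qed
qed

text \<open>It remains to find basic graphs that carry exactly the unequal edges: soft nodes then
  supply the missing vertices, and all remaining edges are equal links.\<close>

lemma obtained_from_UNIV:
  fixes E :: "'a::finite set set"
  assumes "obtained_from B \<mu> x V (unequal_edges x E)" "simple_graph E" "connected_graph E" "V \<noteq> {}"
    and "\<And>v. v \<notin> V \<Longrightarrow> x v = 0" "\<And>v w. {v, w} \<in> E \<Longrightarrow> w \<notin> V \<Longrightarrow> x v = 0"
  shows "obtained_from B \<mu> x UNIV E"
proof -
  obtain D' where D': "obtained_from B \<mu> x UNIV (unequal_edges x E \<union> D')"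
      "D' \<subseteq> E - unequal_edges x E"
    using obtained_from_soft_closure[OF assms(1,3,4,5)] assms(6) by blast
  have "obtained_from B \<mu> x UNIV (unequal_edges x E \<union> D' \<union> (E - unequal_edges x E))"
    using D'(1) by (rule obtained_from_link_set)
      (use assms(2) in \<open>auto simp: unequal_edges_def simple_graph_def\<close>)
  moreover have "unequal_edges x E \<union> D' \<union> (E - unequal_edges x E) = E"
    using D'(2) by (auto simp: unequal_edges_def)
  ultimately show ?thesis by simp
qed


subsection \<open>Recognising patterned cycles\<close>

text \<open>A simple graph is determined by its neighbourhoods, so another listing of the same cycle
  is recognised from consecutive triples, without rearranging edge sets.\<close>

lemma cycle_onI_nbh:
  assumes "cycle_on c V E" "distinct d" "set d = V" "length d = length c"
    and "\<And>i. nbh E (d ! (Suc i mod length d)) = {d ! (i mod length d), d ! (Suc (Suc i) mod length d)}"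
  shows "cycle_on d V E"
proof -
  have d: "cycle_on d V (cycle_edges d)"
    using assms by (simp add: cycle_on_def)
  have "nbh (cycle_edges d) v = nbh E v" for v
  proof (cases "v \<in> V")
    case True
    then obtain i where "v = d ! (Suc i mod length d)"
      using assms(3) set_cycle_nthE by metis
    then show ?thesis
      using assms(5)[of i] nbh_cycle_edges[of d i] d by (simp add: cycle_on_def)
  next
    case False
    then have "v \<notin> \<Union>(cycle_edges d)" "v \<notin> \<Union>E"
      using assms(1,3) by (auto simp: cycle_on_def Union_cycle_edges)
    then show ?thesis
      by (auto simp: nbh_def)
  qed
  then have "{u, v} \<in> cycle_edges d \<longleftrightarrow> {u, v} \<in> E" for u v
    by (auto simp: nbh_def)
  moreover have "simple_graph E" "simple_graph (cycle_edges d)"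
    using assms(1) d by (auto intro: simple_graph_cycle)
  ultimately have "cycle_edges d = E"
    by (metis simple_graph_edgeE subsetI subset_antisym)
  with d show ?thesis by simp
qed

lemma cycle_on_rotate:
  assumes "cycle_on c V E"
  shows "cycle_on (rotate m c) V E"
proof (rule cycle_onI_nbh[OF assms])
  fix i
  have c: "distinct c" "3 \<le> length c" "E = cycle_edges c" "c \<noteq> []"
    using assms by (auto simp: cycle_on_def)
  have nth: "rotate m c ! (j mod length c) = c ! ((m + j) mod length c)" for j
    using c by (simp add: nth_rotate mod_add_right_eq)
  show "nbh E (rotate m c ! (Suc i mod length (rotate m c))) =
      {rotate m c ! (i mod length (rotate m c)), rotate m c ! (Suc (Suc i) mod length (rotate m c))}"
    using nbh_cycle_edges(1)[OF c(1,2), of "m + i"] c(3) by (simp add: nth)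
qed (use assms in \<open>auto simp: cycle_on_def\<close>)

text \<open>Reversal sends index \<open>i\<close> to \<open>n - 1 - i\<close>; modulo
  \<open>n\<close> this turns successors into predecessors.\<close>

lemma reflect_index:
  "0 < n \<Longrightarrow> n - 1 - i mod n = Suc (n - 1 - Suc i mod n) mod n" for i n :: nat
  using mod_less_divisor[of n i] by (auto simp: mod_Suc Suc_diff_Suc simp del: mod_less_divisor)

lemma cycle_on_rev:
  assumes "cycle_on c V E"
  shows "cycle_on (rev c) V E"
proof (rule cycle_onI_nbh[OF assms])
  fix i
  define n where "n = length c"
  have c: "distinct c" "3 \<le> length c" "E = cycle_edges c" "0 < n"
    using assms by (auto simp: cycle_on_def n_def)
  have nth: "rev c ! (j mod n) = c ! (n - 1 - j mod n)" for j
    using c by (simp add: n_def rev_nth)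
  \<comment> \<open>The reflection of \<open>Suc (Suc i)\<close>: its two successors in
    \<open>c\<close> are the reflections of \<open>Suc i\<close> and \<open>i\<close>.\<close>
  define j where "j = n - 1 - Suc (Suc i) mod n"
  have "j mod n = n - 1 - Suc (Suc i) mod n"
    using c by (simp add: j_def)
  moreover have 1: "Suc j mod n = n - 1 - Suc i mod n"
    using reflect_index[OF c(4), of "Suc i"] by (simp add: j_def)
  moreover have "Suc (Suc j) mod n = n - 1 - i mod n"
    using reflect_index[OF c(4), of i] 1 by (metis mod_Suc_eq)
  ultimately show "nbh E (rev c ! (Suc i mod length (rev c))) =
      {rev c ! (i mod length (rev c)), rev c ! (Suc (Suc i) mod length (rev c))}"
    using nbh_cycle_edges(1)[OF c(1,2), of j] c(3)
    by (simp add: nth n_def[symmetric] insert_commute)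
qed (use assms in \<open>auto simp: cycle_on_def\<close>)

text \<open>A rotation brings \<open>u\<close> to the front; if \<open>v\<close> is its predecessor,
  a reversal is needed as well.\<close>

lemma cycle_on_start:
  assumes "cycle_on c V E" "{u, v} \<in> E"
  obtains d where "cycle_on d V E" "d ! 0 = u" "d ! 1 = v"
proof -
  define n where "n = length c"
  have c: "distinct c" "3 \<le> length c" "E = cycle_edges c" "V = set c" "3 \<le> n" "c \<noteq> []"
    using assms by (auto simp: cycle_on_def n_def)
  then have "u \<in> set c"
    using assms(2) Union_cycle_edges[of c] by auto
  then obtain i where u: "u = c ! (Suc i mod n)"
    by (auto simp: n_def elim: set_cycle_nthE)
  have nth: "rotate m c ! j = c ! ((m + j) mod n)" if "j < n" for j m
    using that by (simp add: nth_rotate n_def)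
  have "v = c ! (i mod n) \<or> v = c ! (Suc (Suc i) mod n)"
    using nbh_cycle_edges(1)[OF c(1,2), of i] assms(2) c(3) u by (auto simp: nbh_def n_def)
  then show ?thesis
  proof
    assume v: "v = c ! (Suc (Suc i) mod n)"
    show ?thesis
    proof (rule that)
      show "cycle_on (rotate (Suc i) c) V E"
        using assms(1) by (rule cycle_on_rotate)
      show "rotate (Suc i) c ! 0 = u" "rotate (Suc i) c ! 1 = v"
        using u v c(5) by (simp_all add: nth del: rotate_Suc)
    qed
  next
    assume v: "v = c ! (i mod n)"
    show ?thesis
    proof (rule that)
      \<comment> \<open>Rotating by \<open>i + 2\<close> puts \<open>v\<close> and \<open>u\<close>
        in the last two positions, which reversal turns into \<open>u\<close> and \<open>v\<close>
        at the front.\<close>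
      show "cycle_on (rev (rotate (i + 2) c)) V E"
        using assms(1) by (intro cycle_on_rev cycle_on_rotate)
      have "i + 2 + (n - 1) = Suc i + n" "i + 2 + (n - 2) = i + n"
        using c(5) by auto
      moreover have "rev (rotate (i + 2) c) ! 0 = c ! ((i + 2 + (n - 1)) mod n)"
          "rev (rotate (i + 2) c) ! 1 = c ! ((i + 2 + (n - 2)) mod n)"
        using c(5) by (simp_all add: rev_nth nth n_def[symmetric] numeral_2_eq_2 del: rotate_Suc add_Suc_right)
      ultimately show "rev (rotate (i + 2) c) ! 0 = u" "rev (rotate (i + 2) c) ! 1 = v"
        by (simp_all only: u v mod_add_self2)
    qed
  qed
qed

text \<open>Two consecutive values determine the next, so the pattern propagates around the cycle.
  The first value of \<open>p\<close> must not recur within \<open>p\<close>, so that the pattern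
  can close up only after whole periods.\<close>

lemma patterned_cycleI:
  assumes "cycle_on c V E" "p \<noteq> []" "\<And>j. j < length p \<Longrightarrow> p ! j = p ! 0 \<Longrightarrow> j = 0"
    and "x (c ! 0) = p ! 0" "x (c ! 1) = p ! (1 mod length p)"
    and step: "\<And>i. x (c ! (i mod length c)) = p ! (i mod length p) \<Longrightarrow>
      x (c ! (Suc i mod length c)) = p ! (Suc i mod length p) \<Longrightarrow>
      x (c ! (Suc (Suc i) mod length c)) = p ! (Suc (Suc i) mod length p)"
  shows "patterned_cycle p x V E"
proof -
  define n where "n = length c"
  have n: "3 \<le> n"
    using assms(1) by (simp add: cycle_on_def n_def)
  have "x (c ! (i mod n)) = p ! (i mod length p) \<and> x (c ! (Suc i mod n)) = p ! (Suc i mod length p)" for i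
  proof (induction i)
    case 0
    then show ?case using assms(4,5) n by simp
  next
    case (Suc i)
    then show ?case using step[of i] by (simp add: n_def)
  qed
  then have nth: "x (c ! (i mod n)) = p ! (i mod length p)" for i
    by blast
  \<comment> \<open>Position \<open>n\<close> is position 0 again, hence carries the first value of
    the pattern.\<close>
  have "n mod length p = 0"
  proof (rule assms(3))
    show "n mod length p < length p"
      using assms(2) by simp
    show "p ! (n mod length p) = p ! 0"
      using nth[of n] assms(4) by simp
  qed
  then obtain k where k: "n = k * length p"
    by (metis dvd_imp_mod_0 mod_0_imp_dvd dvd_def mult.commute)
  then have "map x c = concat (replicate k p)"
    using nth by (intro patternI) (simp_all add: n_def)
  moreover have "k \<ge> 1"
    using k n by (cases k) auto
  ultimately show ?thesis
    using assms(1) by (auto simp: patterned_cycle_def)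
qed

text \<open>The two neighbours of a vertex carry the two values it does not have itself. Knowing the
  predecessor therefore fixes the successor.\<close>

lemma basic_C3kI:
  assumes "cycle_on c V E" "{u, v} \<in> E" "x u = 1" "x v = 0"
    and nb: "\<And>v r. v \<in> V \<Longrightarrow> r \<in> {-1, 0, 1} \<Longrightarrow> r \<noteq> x v \<Longrightarrow> \<exists>w\<in>nbh E v. x w = r"
  shows "basic_C3k x V E"
proof -
  obtain d where d: "cycle_on d V E" "d ! 0 = u" "d ! 1 = v"
    using assms cycle_on_start by metis
  have len: "3 \<le> length d" "distinct d" "V = set d" "E = cycle_edges d" "0 < length d"
    using d by (auto simp: cycle_on_def)
  show ?thesis
    using d(1)
  proof (rule patterned_cycleI)
    fix i
    let ?p = "[1, 0, -1 :: real]"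
    assume 0: "x (d ! (i mod length d)) = ?p ! (i mod length ?p)"
      and 1: "x (d ! (Suc i mod length d)) = ?p ! (Suc i mod length ?p)"
    have "d ! (Suc i mod length d) \<in> V"
      using len by simp
    \<comment> \<open>The value that the pattern expects next must occur at a neighbour, and the
      predecessor has a different value.\<close>
    note nb' = nb[OF this, unfolded len(4) nbh_cycle_edges(1)[OF len(2,1)] 1, of "?p ! (Suc (Suc i) mod length ?p)"]
    have "i mod 3 = 0 \<or> i mod 3 = 1 \<or> i mod 3 = 2"
      by linarith
    then show "x (d ! (Suc (Suc i) mod length d)) = ?p ! (Suc (Suc i) mod length ?p)"
      using nb' 0 len(1) by (auto simp: mod_Suc)
  next
    fix j
    let ?p = "[1, 0, -1 :: real]"
    assume "j < length ?p" and p: "?p ! j = ?p ! 0"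
    then have "j = 0 \<or> j = 1 \<or> j = 2"
      by (simp add: less_Suc_eq numeral_2_eq_2)
    then show "j = 0"
      using p by auto
  qed (simp_all add: d(2) d(3) assms(3,4) del: One_nat_def)
qed

text \<open>After a nonzero vertex comes a soft one; at a soft vertex both signs occur, so the
  successor has the sign opposite to the predecessor.\<close>

lemma basic_C4kI:
  assumes "cycle_on c V E" "{u, v} \<in> E" "x u = 1" "x v = 0"
    and nb0: "\<And>v r. v \<in> V \<Longrightarrow> r \<in> {-1, 1} \<Longrightarrow> x v = 0 \<Longrightarrow> \<exists>w\<in>nbh E v. x w = r"
    and nb1: "\<And>v w. w \<in> nbh E v \<Longrightarrow> x v \<noteq> 0 \<Longrightarrow> x w = 0"
  shows "basic_C4k x V E"
proof -
  obtain d where d: "cycle_on d V E" "d ! 0 = u" "d ! 1 = v"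
    using assms cycle_on_start by metis
  have len: "3 \<le> length d" "distinct d" "V = set d" "E = cycle_edges d" "0 < length d"
    using d by (auto simp: cycle_on_def)
  show ?thesis
    using d(1)
  proof (rule patterned_cycleI)
    fix i
    let ?p = "[1, 0, -1, 0 :: real]"
    assume 0: "x (d ! (i mod length d)) = ?p ! (i mod length ?p)"
      and 1: "x (d ! (Suc i mod length d)) = ?p ! (Suc i mod length ?p)"
    have "d ! (Suc i mod length d) \<in> V"
      using len by simp
    note nb0' = nb0[OF this, unfolded len(4) nbh_cycle_edges(1)[OF len(2,1)] 1, of "?p ! (Suc (Suc i) mod length ?p)"]
    have "d ! (Suc (Suc i) mod length d) \<in> nbh E (d ! (Suc i mod length d))"
      unfolding len(4) nbh_cycle_edges(1)[OF len(2,1)] by simp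
    note nb1' = nb1[OF this, unfolded 1]
    have "i mod 4 = 0 \<or> i mod 4 = 1 \<or> i mod 4 = 2 \<or> i mod 4 = 3"
      by linarith
    then show "x (d ! (Suc (Suc i) mod length d)) = ?p ! (Suc (Suc i) mod length ?p)"
      using nb0' nb1' 0 len(1) by (auto simp: mod_Suc)
  next
    fix j
    let ?p = "[1, 0, -1, 0 :: real]"
    assume "j < length ?p" and p: "?p ! j = ?p ! 0"
    then have "j = 0 \<or> j = 1 \<or> j = 2 \<or> j = 3"
      by (simp add: less_Suc_eq numeral_2_eq_2 numeral_3_eq_3)
    then show "j = 0"
      using p by auto
  qed (simp_all add: d(2) d(3) assms(3,4) del: One_nat_def)
qed

subsection \<open>Classification\<close>

lemma unicyclic_unique:
  assumes "unicyclic E" "cycle_on c V C" "C \<subseteq> E" "cycle_on c' V' C'" "C' \<subseteq> E"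
  shows "C = C'"
proof -
  have "\<exists>!C. C \<subseteq> E \<and> (\<exists>c V. cycle_on c V C)"
    using assms(1) by (simp add: unicyclic_def)
  then show ?thesis
    by (rule ex1E) (use assms(2-) in metis)
qed

text \<open>The eigenvalue equation at a vertex, in terms of neighbour counts. The second identity
  is over the reals and shows that \<open>\<mu>\<close> is a natural number as soon as some value is
  nonzero.\<close>

lemma affords_counts:
  fixes E :: "'a::finite set set"
  assumes "affords \<mu> x UNIV E" "range x \<subseteq> {-1, 0, 1}"
  shows "x v = 0 \<Longrightarrow> card (lnbh E x v 1) = card (lnbh E x v (-1))"
    and "x v \<noteq> 0 \<Longrightarrow> real (card (lnbh E x v 0) + 2 * card (lnbh E x v (- x v))) = \<mu>"
proof -
  have lap: "(x v + 1) * card (lnbh E x v (-1)) + x v * card (lnbh E x v 0) +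
      (x v - 1) * card (lnbh E x v 1) = \<mu> * x v"
    using assms lap_count[of x E v] by (simp add: affords_def)
  show "card (lnbh E x v 1) = card (lnbh E x v (-1))" if "x v = 0"
    using lap that by simp
  show "real (card (lnbh E x v 0) + 2 * card (lnbh E x v (- x v))) = \<mu>" if "x v \<noteq> 0"
  proof -
    have "x v = -1 \<or> x v = 1"
      using assms(2) that by auto
    then show ?thesis
      using lap by auto
  qed
qed

text \<open>With at most one opposite neighbour at each vertex of value 1 or -1, the edges between 1
  and -1 form a matching. Indexing it by the ends of value 1 lists each edge once.\<close>

lemma P2_family:
  fixes E :: "'a::finite set set"
  assumes "\<And>v. \<bar>x v\<bar> = 1 \<Longrightarrow> card (lnbh E x v (- x v)) \<le> 1"
  defines "I \<equiv> {u. x u = 1 \<and> lnbh E x u (-1) \<noteq> {}}"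
    and "W \<equiv> \<lambda>u. insert u (lnbh E x u (-1))"
    and "D \<equiv> \<lambda>u. {{u, w} | w. w \<in> lnbh E x u (-1)}"
  shows "u \<in> I \<Longrightarrow> basic_P2 x (W u) (D u)"
    and "disjoint_family_on W I"
    and "(\<Union>u\<in>I. W u) = {v. \<bar>x v\<bar> = 1 \<and> lnbh E x v (- x v) \<noteq> {}}"
    and "(\<Union>u\<in>I. D u) = {{u, w} | u w. {u, w} \<in> E \<and> x u = 1 \<and> x w = -1}"
proof -
  show "basic_P2 x (W u) (D u)" if "u \<in> I"
  proof -
    have "card (lnbh E x u (-1)) = 1"
      using that assms(1)[of u] by (intro antisym) (auto simp: I_def Suc_le_eq card_gt_0_iff)
    then obtain w where w: "lnbh E x u (-1) = {w}"
      by (metis card_1_singletonE)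
    then have "w \<in> lnbh E x u (-1)" by simp
    with that have "x u = 1" "x w = -1" by (auto simp: I_def)
    then show ?thesis
      unfolding basic_P2_def W_def D_def w by (intro exI[of _ u] exI[of _ w]) auto
  qed
  show "disjoint_family_on W I"
    unfolding disjoint_family_on_def
  proof (intro ballI impI)
    fix u u' assume u: "u \<in> I" "u' \<in> I" "u \<noteq> u'"
    have False if "w \<in> W u" "w \<in> W u'" for w
    proof -
      \<comment> \<open>A shared vertex can only be the end of value -1; it would have two opposite
        neighbours.\<close>
      have w: "x w = -1" "u \<in> lnbh E x w 1" "u' \<in> lnbh E x w 1"
        using that u by (auto simp: I_def W_def nbh_sym[of w])
      then have "card {u, u'} \<le> card (lnbh E x w 1)"
        by (intro card_mono) auto
      also have "\<dots> \<le> 1"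
        using assms(1)[of w] w(1) by simp
      finally show False
        using u by simp
    qed
    then show "W u \<inter> W u' = {}" by auto
  qed
  show "(\<Union>u\<in>I. W u) = {v. \<bar>x v\<bar> = 1 \<and> lnbh E x v (- x v) \<noteq> {}}"
  proof (intro set_eqI iffI)
    fix v assume "v \<in> (\<Union>u\<in>I. W u)"
    then show "v \<in> {v. \<bar>x v\<bar> = 1 \<and> lnbh E x v (- x v) \<noteq> {}}"
      by (auto simp: I_def W_def dest: nbh_sym[THEN iffD1])
  next
    fix v assume v: "v \<in> {v. \<bar>x v\<bar> = 1 \<and> lnbh E x v (- x v) \<noteq> {}}"
    then have "x v = 1 \<or> x v = -1" by auto
    then show "v \<in> (\<Union>u\<in>I. W u)"
    proof
      assume "x v = 1"
      then have "v \<in> I" using v by (auto simp: I_def)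
      then show ?thesis by (auto simp: W_def)
    next
      assume "x v = -1"
      then obtain u where "u \<in> nbh E v" "x u = 1" using v by auto
      then have "v \<in> lnbh E x u (-1)"
        using \<open>x v = -1\<close> nbh_sym[of v E u] by simp
      then have "u \<in> I" "v \<in> W u"
        using \<open>x u = 1\<close> by (auto simp: I_def W_def)
      then show ?thesis by blast
    qed
  qed
  show "(\<Union>u\<in>I. D u) = {{u, w} | u w. {u, w} \<in> E \<and> x u = 1 \<and> x w = -1}"
    unfolding I_def D_def nbh_def by blast
qed

text \<open>Orienting each edge from the larger to the smaller value avoids repeating symmetric
  cases.\<close>

lemma unequal_edgesE:
  assumes "simple_graph E" "e \<in> unequal_edges x E"
  obtains u w where "e = {u, w}" "{u, w} \<in> E" "x u > x w"
proof -
  obtain u v where uv: "e = {u, v}" "u \<noteq> v"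
    using assms simple_graph_edgeE[of E e] by (auto simp: unequal_edges_def)
  then have "x u > x v \<or> x v > x u"
    using assms by (auto simp: unequal_edges_def)
  then show ?thesis
    using that[of u v] that[of v u] uv assms by (auto simp: unequal_edges_def insert_commute)
qed

lemma unequal_edges_iff: "{u, v} \<in> unequal_edges x E \<longleftrightarrow> {u, v} \<in> E \<and> x u \<noteq> x v"
  by (auto simp: unequal_edges_def)

text \<open>Without soft vertices the number of opposite neighbours is constantly half of
  \<open>\<mu>\<close>. If it is 1, the unequal edges form a perfect matching; otherwise all of
  \<open>E\<close> has minimum degree 2 and is the cycle.\<close>

lemma bivalent_classification:
  fixes E :: "'a::finite set set"
  assumes simple: "simple_graph E" and uni: "unicyclic E"
    and aff: "affords \<mu> x UNIV E" and ran: "range x = {-1, 1}"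
  shows "\<mu> = 2 \<and> linked_P2_chains E \<or> \<mu> = 4 \<and> even_cycle E"
proof -
  have conn: "connected_graph E"
    using uni by (simp add: unicyclic_def)
  have vals: "x v = -1 \<or> x v = 1" for v
    using ran by auto
  have "x v \<noteq> 0" for v
    using vals[of v] by auto
  then have "lnbh E x v 0 = {}" for v
    by simp
  then have deg: "real (2 * card (lnbh E x v (- x v))) = \<mu>" for v
    using affords_counts(2)[OF aff, of v] ran vals[of v] by auto
  obtain p q where pq: "x p = 1" "x q = -1"
    using ran by (metis imageE insertCI)
  \<comment> \<open>Connectedness yields an edge between the two values, so \<open>\<mu>\<close> is
    positive.\<close>
  obtain u w where uw: "{u, w} \<in> E" "x u = 1" "x w \<noteq> 1"
    using connected_graph_crossing[OF conn, of p "{v. x v = 1}" q] pq by auto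
  then have "w \<in> lnbh E x u (-1)"
    using vals[of w] by (auto simp: nbh_def)
  then have "0 < card (lnbh E x u (-1))"
    by (auto simp: card_gt_0_iff)
  then have pos: "0 < \<mu>"
    using deg[of u] unfolding uw(2) by linarith
  have card_nz: "lnbh E x v (- x v) \<noteq> {}" for v
  proof
    assume "lnbh E x v (- x v) = {}"
    then have "card (lnbh E x v (- x v)) = 0"
      by (simp only: card.empty)
    then show False
      using deg[of v] pos by linarith
  qed
  show ?thesis
  proof (cases "\<mu> = 2")
    case True
    then have one: "card (lnbh E x v (- x v)) \<le> 1" for v
      using deg[of v] by linarith
    let ?I = "{u. x u = 1 \<and> lnbh E x u (-1) \<noteq> {}}"
    let ?W = "\<lambda>u. insert u (lnbh E x u (-1))"
    let ?D = "\<lambda>u. {{u, w} | w. w \<in> lnbh E x u (-1)}"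
    have "equal_linked basic_P2 x (\<Union>u\<in>?I. ?W u) (\<Union>u\<in>?I. ?D u)"
    proof (rule equal_linked_family)
      show "?I \<noteq> {}"
        using \<open>w \<in> lnbh E x u (-1)\<close> uw by blast
      show "disjoint_family_on ?W ?I"
        using one by (rule P2_family)
      show "basic_P2 x (?W u) (?D u)" if "u \<in> ?I" for u
        using that one by (intro P2_family(1)) auto
    qed simp
    moreover have "(\<Union>u\<in>?I. ?W u) = UNIV"
    proof -
      have "\<bar>x v\<bar> = 1" for v
        using vals[of v] by auto
      then show ?thesis
        unfolding P2_family(3)[of x E, OF one] using card_nz by blast
    qed
    moreover have "(\<Union>u\<in>?I. ?D u) = unequal_edges x E"
    proof (subst P2_family(4)[OF one], intro set_eqI iffI)
      fix e assume "e \<in> unequal_edges x E"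
      then obtain u w where "e = {u, w}" "{u, w} \<in> E" "x u > x w"
        using simple by (elim unequal_edgesE)
      moreover have "x u = 1" "x w = -1"
        using \<open>x u > x w\<close> vals[of u] vals[of w] by auto
      ultimately show "e \<in> {{u, w} | u w. {u, w} \<in> E \<and> x u = 1 \<and> x w = -1}"
        by blast
    qed (auto simp: unequal_edges_iff)
    ultimately have "equal_linked basic_P2 x UNIV (unequal_edges x E)"
      by simp
    then have "equal_linked basic_P2 x UNIV (unequal_edges x E \<union> (E - unequal_edges x E))"
      by (rule equal_linked_link_set)
        (use simple in \<open>auto simp: unequal_edges_iff simple_graph_def\<close>)
    moreover have "unequal_edges x E \<union> (E - unequal_edges x E) = E"
      by (auto simp: unequal_edges_def)
    ultimately have "linked_P2_chains E"
      by (auto simp: linked_P2_chains_def)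
    with True show ?thesis by simp
  next
    case False
    have ge2: "2 \<le> card (lnbh E x v (- x v))" for v
    proof -
      have "card (lnbh E x v (- x v)) \<noteq> 0" "card (lnbh E x v (- x v)) \<noteq> 1"
        using deg[of v] pos False by linarith+
      then show ?thesis by linarith
    qed
    have le: "card (lnbh E x v (- x v)) \<le> card (nbh E v)" for v
      by (intro card_mono) auto
    have "\<exists>c. cycle_on c (\<Union>E) E"
    proof (rule min_degree_unicyclic[OF simple])
      show "E \<noteq> {}" using uw by auto
      show "2 \<le> card (nbh E v)" for v
        using ge2 le order_trans by blast
    qed (rule unicyclic_unique[OF uni])
    then obtain c where c: "cycle_on c (\<Union>E) E" by blast
    have "nbh E v \<noteq> {}" for v
      using card_nz[of v] by blast
    then have "\<Union>E = UNIV"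
      using in_Union_iff_nbh[OF simple] by auto
    with c have c: "cycle_on c UNIV E" by simp
    \<comment> \<open>There are only two neighbours on the cycle and at least two opposite ones, so
      all neighbours are opposite.\<close>
    have two: "lnbh E x v (- x v) = nbh E v" for v
    proof (rule card_seteq)
      show "card (nbh E v) \<le> card (lnbh E x v (- x v))"
        using card_nbh_cycle[OF c, of v] ge2[of v] by simp
    qed auto
    have "\<mu> = 4"
      using deg[of u] card_nbh_cycle[OF c, of u] unfolding two by simp
    have alt: "x (c ! (i mod length c)) = (-1) ^ i * x (c ! 0)" for i
    proof (induction i)
      case 0
      then show ?case using c by (simp add: cycle_on_def)
    next
      case (Suc i)
      have cc: "distinct c" "3 \<le> length c" "E = cycle_edges c"
        using c by (auto simp: cycle_on_def)
      have "c ! (i mod length c) \<in> nbh E (c ! (Suc i mod length c))"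
        using nbh_cycle_edges(1)[OF cc(1,2), of i] cc(3) by simp
      then have "x (c ! (i mod length c)) = - x (c ! (Suc i mod length c))"
        using two[of "c ! (Suc i mod length c)"] by blast
      then show ?case
        using Suc.IH by simp
    qed
    \<comment> \<open>The sign flips at each step and must be restored after one full turn.\<close>
    have "(-1) ^ length c * x (c ! 0) = x (c ! 0)"
      using alt[of "length c"] by simp
    then have "even (length c)"
      using vals[of "c ! 0"] by (auto simp: minus_one_power_iff split: if_splits)
    then have "even_cycle E"
      using c by (auto simp: even_cycle_def)
    with \<open>\<mu> = 4\<close> show ?thesis by simp
  qed
qed

text \<open>For eigenvalue 1 a nonzero vertex has exactly one soft neighbour and no opposite one. It
  is thus a leaf at a unique centre, and the equation at the centre balances the signs.\<close>

lemma star_family: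
  fixes E :: "'a::finite set set"
  assumes simple: "simple_graph E"
    and aff: "affords 1 x UNIV E" and ran: "range x \<subseteq> {-1, 0, 1}"
  defines "Z \<equiv> {z. x z = 0 \<and> (\<exists>w\<in>nbh E z. x w \<noteq> 0)}"
    and "W \<equiv> \<lambda>z. insert z {w \<in> nbh E z. x w \<noteq> 0}"
    and "D \<equiv> \<lambda>z. {{z, w} | w. w \<in> nbh E z \<and> x w \<noteq> 0}"
  shows "z \<in> Z \<Longrightarrow> basic_star x (W z) (D z)"
    and "disjoint_family_on W Z"
    and "(\<Union>z\<in>Z. W z) = {v. x v \<noteq> 0 \<or> (\<exists>w\<in>nbh E v. x w \<noteq> 0)}"
    and "(\<Union>z\<in>Z. D z) = unequal_edges x E"
proof -
  have vals: "x v = -1 \<or> x v = 0 \<or> x v = 1" for v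
    using ran by auto
  have "card (lnbh E x v 0) + 2 * card (lnbh E x v (- x v)) = 1" if "x v \<noteq> 0" for v
    using affords_counts(2)[OF aff ran that] by linarith
  then have one: "card (lnbh E x v 0) = 1" and none: "lnbh E x v (- x v) = {}" if "x v \<noteq> 0" for v
    using that by (force simp: add_is_1)+
  show "basic_star x (W z) (D z)" if "z \<in> Z"
  proof -
    have z: "x z = 0" "card (lnbh E x z 1) = card (lnbh E x z (-1))"
      using that affords_counts(1)[OF aff ran] by (auto simp: Z_def)
    have split: "{w \<in> nbh E z. x w \<noteq> 0} = lnbh E x z 1 \<union> lnbh E x z (-1)"
      using vals by auto
    then have "lnbh E x z 1 \<noteq> {} \<or> lnbh E x z (-1) \<noteq> {}"
      using that by (auto simp: Z_def)
    then have "card (lnbh E x z 1) \<noteq> 0"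
      using z(2) by (metis card_0_eq finite)
    then have "1 \<le> card (lnbh E x z 1)"
      by linarith
    moreover have "D z = {{z, v} | v. v \<in> lnbh E x z 1 \<union> lnbh E x z (-1)}"
      unfolding D_def split[symmetric] by simp
    moreover have "W z = insert z (lnbh E x z 1 \<union> lnbh E x z (-1))"
      unfolding W_def split ..
    ultimately show ?thesis
      unfolding basic_star_def
      by (intro exI[of _ z] exI[of _ "lnbh E x z 1"] exI[of _ "lnbh E x z (-1)"]
          exI[of _ "card (lnbh E x z 1)"] conjI) (simp_all add: z disjoint_iff)
  qed
  show "disjoint_family_on W Z"
    unfolding disjoint_family_on_def
  proof (intro ballI impI)
    fix u u' assume u: "u \<in> Z" "u' \<in> Z" "u \<noteq> u'"
    have False if "w \<in> W u" "w \<in> W u'" for w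
    proof -
      \<comment> \<open>A shared vertex must be a leaf, since centres are soft; it would have two
        soft neighbours.\<close>
      have w: "x w \<noteq> 0" "u \<in> lnbh E x w 0" "u' \<in> lnbh E x w 0"
        using that u by (auto simp: Z_def W_def nbh_sym[of w])
      then have "card {u, u'} \<le> card (lnbh E x w 0)"
        by (intro card_mono) auto
      then show False
        using u one[OF w(1)] by simp
    qed
    then show "W u \<inter> W u' = {}" by auto
  qed
  have centre: "\<exists>z\<in>Z. v \<in> W z" if nz: "x v \<noteq> 0" for v
  proof -
    have "lnbh E x v 0 \<noteq> {}"
      using one[OF nz] by force
    then obtain z where "z \<in> nbh E v" "x z = 0"
      by blast
    then have "v \<in> nbh E z" "x z = 0"
      using nbh_sym[of z E v] by auto
    then have "z \<in> Z" "v \<in> W z"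
      using nz by (auto simp: Z_def W_def)
    then show ?thesis by blast
  qed
  show "(\<Union>z\<in>Z. W z) = {v. x v \<noteq> 0 \<or> (\<exists>w\<in>nbh E v. x w \<noteq> 0)}"
  proof (intro set_eqI iffI)
    fix v assume v: "v \<in> {v. x v \<noteq> 0 \<or> (\<exists>w\<in>nbh E v. x w \<noteq> 0)}"
    show "v \<in> (\<Union>z\<in>Z. W z)"
    proof (cases "x v = 0")
      case True
      then have "v \<in> Z" using v by (auto simp: Z_def)
      then show ?thesis by (auto simp: W_def)
    next
      case False
      then show ?thesis using centre by blast
    qed
  qed (auto simp: Z_def W_def)
  show "(\<Union>z\<in>Z. D z) = unequal_edges x E"
  proof (intro set_eqI iffI)
    fix e assume "e \<in> unequal_edges x E"
    then obtain u w where uw: "e = {u, w}" "{u, w} \<in> E" "x u > x w"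
      using simple by (elim unequal_edgesE)
    have "x u = 0 \<or> x w = 0"
    proof (rule ccontr)
      assume "\<not> (x u = 0 \<or> x w = 0)"
      then have "x u = 1" "x w = -1"
        using uw(3) vals[of u] vals[of w] by auto
      then show False
        using none[of u] uw(2) by (auto simp: nbh_def)
    qed
    then show "e \<in> (\<Union>z\<in>Z. D z)"
    proof
      assume "x u = 0"
      then have "u \<in> Z" "e \<in> D u"
        using uw by (auto simp: Z_def D_def nbh_def intro!: bexI[of _ w])
      then show ?thesis by blast
    next
      assume "x w = 0"
      then have "w \<in> Z" "e \<in> D w"
        using uw by (auto simp: Z_def D_def nbh_def insert_commute intro!: bexI[of _ u])
      then show ?thesis by blast
    qed
  qed (auto simp: Z_def D_def nbh_def unequal_edges_iff)
qed

lemma trivalent_classification_1: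
  fixes E :: "'a::finite set set"
  assumes simple: "simple_graph E" and conn: "connected_graph E"
    and aff: "affords 1 x UNIV E" and ran: "range x \<subseteq> {-1, 0, 1}"
    and uw: "{u, w} \<in> E" "x u = 0" "x w \<noteq> 0"
  shows "obtained_from_stars E"
proof -
  let ?Z = "{z. x z = 0 \<and> (\<exists>w\<in>nbh E z. x w \<noteq> 0)}"
  let ?W = "\<lambda>z. insert z {w \<in> nbh E z. x w \<noteq> 0}"
  let ?D = "\<lambda>z. {{z, w} | w. w \<in> nbh E z \<and> x w \<noteq> 0}"
  note fam = star_family[OF simple aff ran]
  have u: "u \<in> ?Z"
    using uw by (auto simp: nbh_def)
  \<comment> \<open>The star at \<open>u\<close> is the initial graph; the others are joined to
    it.\<close>
  have "obtained_from basic_star 1 x (?W u \<union> (\<Union>z\<in>?Z - {u}. ?W z)) (?D u \<union> (\<Union>z\<in>?Z - {u}. ?D z))"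
  proof (rule obtained_from_family)
    show "obtained_from basic_star 1 x (?W u) (?D u)"
      using fam(1)[OF u] by (rule obtained_from.start)
    show "basic_graph 1 x (?W z) (?D z)" if "z \<in> ?Z - {u}" for z
      using fam(1)[of z] that by (intro basic_graph.star) blast
    show "disjoint_family_on ?W (?Z - {u})"
      using fam(2) by (rule disjoint_family_on_mono[rotated]) auto
    show "?W u \<inter> ?W z = {}" if "z \<in> ?Z - {u}" for z
      using fam(2) u that unfolding disjoint_family_on_def by blast
  qed simp
  moreover have "?W u \<union> (\<Union>z\<in>?Z - {u}. ?W z) = (\<Union>z\<in>?Z. ?W z)"
      "?D u \<union> (\<Union>z\<in>?Z - {u}. ?D z) = (\<Union>z\<in>?Z. ?D z)"
    using u by blast+
  ultimately have "obtained_from basic_star 1 x {v. x v \<noteq> 0 \<or> (\<exists>w\<in>nbh E v. x w \<noteq> 0)}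
      (unequal_edges x E)"
    using fam(3,4) by simp
  \<comment> \<open>A vertex outside all stars is soft and has only soft neighbours, as the
    extension by soft nodes requires.\<close>
  then have "obtained_from basic_star 1 x UNIV E"
    using simple conn
  proof (rule obtained_from_UNIV)
    show "{v. x v \<noteq> 0 \<or> (\<exists>w\<in>nbh E v. x w \<noteq> 0)} \<noteq> {}"
      using uw by blast
  qed (auto simp: nbh_def insert_commute)
  then show ?thesis
    by (auto simp: obtained_from_stars_def)
qed

text \<open>For eigenvalue 2 a nonzero vertex has either two soft neighbours and no opposite one, or
  no soft neighbour and one opposite one. The former lie on the cycle, the latter form the copies of
  \<open>P\<^sub>2\<close>.\<close>

lemma trivalent_classification_2:
  fixes E :: "'a::finite set set"
  assumes simple: "simple_graph E" and uni: "unicyclic E"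
    and aff: "affords 2 x UNIV E" and ran: "range x \<subseteq> {-1, 0, 1}"
    and uw: "{u, w} \<in> E" "x u = 0" "x w \<noteq> 0"
  shows "obtained_from_C4k E"
proof -
  have vals: "x v = -1 \<or> x v = 0 \<or> x v = 1" for v
    using ran by auto
  have nonzero: "card (lnbh E x v 0) + 2 * card (lnbh E x v (- x v)) = 2" if "x v \<noteq> 0" for v
    using affords_counts(2)[OF aff ran that] by linarith
  have zero: "card (lnbh E x v 1) = card (lnbh E x v (-1))" if "x v = 0" for v
    using affords_counts(1)[OF aff ran that] .
  define F where "F = {e \<in> E. \<exists>u\<in>e. \<exists>v\<in>e. x u = 0 \<and> x v \<noteq> 0}"
  have F: "F \<subseteq> E" "simple_graph F"
    using simple by (auto simp: F_def simple_graph_def)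
  have F_iff: "{a, b} \<in> F \<longleftrightarrow> {a, b} \<in> E \<and> (x a = 0) \<noteq> (x b = 0)" for a b
    by (auto simp: F_def)
  have nbhF0: "nbh F v = lnbh E x v 1 \<union> lnbh E x v (-1)" if "x v = 0" for v
    using that vals by (auto simp: nbh_def F_iff)
  have nbhF1: "nbh F v = lnbh E x v 0" if "x v \<noteq> 0" for v
    using that by (auto simp: nbh_def F_iff)
  have cardF0: "card (nbh F v) = 2 * card (lnbh E x v 1)" if "x v = 0" for v
    using zero[OF that] unfolding nbhF0[OF that] by (subst card_Un_disjoint) auto
  have deg: "2 \<le> card (nbh F v)" if "v \<in> \<Union>F" for v
  proof -
    have "card (nbh F v) \<noteq> 0"
      using that in_Union_iff_nbh[OF F(2)] by simp
    \<comment> \<open>Parity gives the minimum degree: soft vertices have balanced neighbours, and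
      at other vertices the count of soft neighbours is 2 minus an even number.\<close>
    moreover have "even (card (nbh F v))"
    proof (cases "x v = 0")
      case False
      then show ?thesis
        using nonzero[OF False] nbhF1[OF False] by (metis dvd_triv_left even_add even_numeral)
    qed (simp add: cardF0)
    ultimately show ?thesis
      by presburger
  qed
  have "\<exists>c. cycle_on c (\<Union>F) F"
  proof (rule min_degree_unicyclic[OF F(2)])
    show "F \<noteq> {}"
      using uw by (auto simp: F_def)
  qed (use deg unicyclic_unique[OF uni] F(1) in \<open>blast+\<close>)
  then obtain c where c: "cycle_on c (\<Union>F) F" by blast
  have C4k: "basic_C4k x (\<Union>F) F"
  proof -
    have "u \<in> \<Union>F"
      using uw by (auto simp: F_def)
    then have "2 \<le> 2 * card (lnbh E x u 1)"
      using deg[of u] cardF0[OF uw(2)] by simp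
    then have "lnbh E x u 1 \<noteq> {}"
      by (metis card.empty mult_0_right not_numeral_le_zero)
    then obtain p where p: "{p, u} \<in> F" "x p = 1"
      using uw(2) by (auto simp: F_iff nbh_def insert_commute)
    show ?thesis
      using c p(1,2) uw(2)
    proof (rule basic_C4kI)
      fix v and r :: real assume v: "v \<in> \<Union>F" "r \<in> {-1, 1}" "x v = 0"
      then have "card (lnbh E x v 1) \<noteq> 0"
        using deg[of v] cardF0[of v] by linarith
      moreover have "card (lnbh E x v r) = card (lnbh E x v 1)"
        using v zero[of v] by auto
      ultimately have "card (lnbh E x v r) \<noteq> 0"
        by metis
      then have "lnbh E x v r \<noteq> {}"
        by (metis card.empty)
      then show "\<exists>w\<in>nbh F v. x w = r"
        using v nbhF0[of v] by auto
    next
      fix v w assume "w \<in> nbh F v" "x v \<noteq> 0"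
      then show "x w = 0"
        by (simp add: nbhF1)
    qed
  qed
  have P2: "card (lnbh E x v (- x v)) \<le> 1" if "\<bar>x v\<bar> = 1" for v
  proof -
    have "x v \<noteq> 0"
      using that by auto
    then show ?thesis
      using nonzero[of v] by linarith
  qed
  let ?I = "{u. x u = 1 \<and> lnbh E x u (-1) \<noteq> {}}"
  let ?W = "\<lambda>u. insert u (lnbh E x u (-1))"
  let ?D = "\<lambda>u. {{u, w} | w. w \<in> lnbh E x u (-1)}"
  let ?P = "{v. \<bar>x v\<bar> = 1 \<and> lnbh E x v (- x v) \<noteq> {}}"
  have W: "(\<Union>u\<in>?I. ?W u) = ?P"
    by (rule P2_family(3)) (rule P2)
  have D: "(\<Union>u\<in>?I. ?D u) = {{u, w} | u w. {u, w} \<in> E \<and> x u = 1 \<and> x w = -1}"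
    by (rule P2_family(4)) (rule P2)
  \<comment> \<open>An opposite neighbour uses up the whole eigenvalue 2, leaving no soft neighbour
    and hence no edge of \<open>F\<close>.\<close>
  have disj: "\<Union>F \<inter> ?P = {}"
  proof (intro set_eqI iffI)
    fix v assume "v \<in> \<Union>F \<inter> ?P"
    then have v: "v \<in> \<Union>F" "x v \<noteq> 0" and "lnbh E x v (- x v) \<noteq> {}"
      by auto
    then have "card (lnbh E x v (- x v)) \<noteq> 0"
      by (metis card_0_eq finite)
    then have "card (nbh F v) = 0"
      using nonzero[OF v(2)] unfolding nbhF1[OF v(2)] by linarith
    then show "v \<in> {}"
      using deg[OF v(1)] by linarith
  qed simp
  have "obtained_from basic_C4k 2 x (\<Union>F \<union> (\<Union>u\<in>?I. ?W u)) (F \<union> (\<Union>u\<in>?I. ?D u))"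
  proof (rule obtained_from_family)
    show "obtained_from basic_C4k 2 x (\<Union>F) F"
      using C4k by (rule obtained_from.start)
    show "basic_graph 2 x (?W u) (?D u)" if "u \<in> ?I" for u
      using that by (intro basic_graph.P2 P2_family(1) P2)
    show "disjoint_family_on ?W ?I"
      by (rule P2_family(2)) (rule P2)
    show "\<Union>F \<inter> ?W u = {}" if "u \<in> ?I" for u
    proof -
      have "?W u \<subseteq> (\<Union>u\<in>?I. ?W u)"
        using that by (rule UN_upper)
      then have "?W u \<subseteq> ?P"
        unfolding W .
      then show ?thesis
        using disj by blast
    qed
  qed simp
  \<comment> \<open>An unequal edge has a soft end, and lies in \<open>F\<close>, or joins 1 to
    -1.\<close>
  moreover have "F \<union> (\<Union>u\<in>?I. ?D u) = unequal_edges x E"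
    unfolding D
  proof (intro set_eqI iffI)
    fix e assume "e \<in> unequal_edges x E"
    then obtain u w where e: "e = {u, w}" "{u, w} \<in> E" "x u > x w"
      using simple by (elim unequal_edgesE)
    show "e \<in> F \<union> {{u, w} | u w. {u, w} \<in> E \<and> x u = 1 \<and> x w = -1}"
    proof (cases "x u = 0 \<or> x w = 0")
      case True
      then show ?thesis using e by (auto simp: F_iff)
    next
      case False
      then have "x u = 1" "x w = -1"
        using e(3) vals[of u] vals[of w] by auto
      then show ?thesis using e by blast
    qed
  next
    have "F \<subseteq> unequal_edges x E"
      unfolding F_def unequal_edges_def by (intro Collect_mono) metis
    moreover fix e assume "e \<in> F \<union> {{u, w} | u w. {u, w} \<in> E \<and> x u = 1 \<and> x w = -1}"
    ultimately show "e \<in> unequal_edges x E"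
      by (auto simp: unequal_edges_iff)
  qed
  ultimately have "obtained_from basic_C4k 2 x (\<Union>F \<union> ?P) (unequal_edges x E)"
    by (simp only: W)
  then have "obtained_from basic_C4k 2 x UNIV E"
    using simple
  proof (rule obtained_from_UNIV)
    show "connected_graph E"
      using uni by (simp add: unicyclic_def)
    show "\<Union>F \<union> ?P \<noteq> {}"
      using uw by (auto simp: F_def)
    \<comment> \<open>A nonzero vertex outside would have neither soft nor opposite neighbours,
      against the count 2.\<close>
    show soft: "x v = 0" if "v \<notin> \<Union>F \<union> ?P" for v
    proof (rule ccontr)
      assume v: "x v \<noteq> 0"
      then have "\<bar>x v\<bar> = 1"
        using vals[of v] by auto
      then have "lnbh E x v (- x v) = {}"
        using that by blast
      then have "card (lnbh E x v (- x v)) = 0"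
        by (simp only: card.empty)
      moreover have "nbh F v = {}"
        using that in_Union_iff_nbh[OF F(2), of v] by blast
      then have "card (lnbh E x v 0) = 0"
        unfolding nbhF1[OF v] by (simp only: card.empty)
      ultimately show False
        using nonzero[OF v] by linarith
    qed
    show "x v = 0" if "{v, w} \<in> E" "w \<notin> \<Union>F \<union> ?P" for v w
    proof -
      have "x w = 0"
        using that(2) by (rule soft)
      moreover have "{v, w} \<notin> F"
        using that(2) by blast
      ultimately show ?thesis
        using that(1) F_iff[of v w] by simp
    qed
  qed
  then show ?thesis
    by (auto simp: obtained_from_C4k_def)
qed

text \<open>Let a nonzero vertex have a soft and b opposite neighbours. From a + 2b > 2 follows a +
  b \<ge> 2, so the unequal edges have minimum degree 2 and form the cycle; then a + b = 2 at every
  nonzero vertex.\<close>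

lemma trivalent_classification_3:
  fixes E :: "'a::finite set set"
  assumes simple: "simple_graph E" and uni: "unicyclic E"
    and aff: "affords \<mu> x UNIV E" and ran: "range x \<subseteq> {-1, 0, 1}"
    and uw: "{u, w} \<in> E" "x u = 0" "x w \<noteq> 0" and ge: "\<mu> > 2"
  shows "\<mu> = 3" and "obtained_from_C3k E"
proof -
  have vals: "x v = -1 \<or> x v = 0 \<or> x v = 1" for v
    using ran by auto
  have nonzero: "real (card (lnbh E x v 0) + 2 * card (lnbh E x v (- x v))) = \<mu>" if "x v \<noteq> 0" for v
    using affords_counts(2)[OF aff ran that] .
  have zero: "card (lnbh E x v 1) = card (lnbh E x v (-1))" if "x v = 0" for v
    using affords_counts(1)[OF aff ran that] .
  define F where "F = unequal_edges x E"
  have F: "F \<subseteq> E" "simple_graph F"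
    using simple by (auto simp: F_def unequal_edges_def simple_graph_def)
  have F_iff: "{a, b} \<in> F \<longleftrightarrow> {a, b} \<in> E \<and> x a \<noteq> x b" for a b
    by (auto simp: F_def unequal_edges_iff)
  have nbhF: "nbh F v = {w \<in> nbh E v. x w \<noteq> x v}" for v
    by (simp add: F_def nbh_unequal_edges)
  have cardF0: "card (nbh F v) = 2 * card (lnbh E x v 1)" if "x v = 0" for v
  proof -
    have "nbh F v = lnbh E x v 1 \<union> lnbh E x v (-1)"
      using that vals by (auto simp: nbhF)
    then show ?thesis
      using zero[OF that] by (simp, subst card_Un_disjoint) auto
  qed
  have cardF1: "card (nbh F v) = card (lnbh E x v 0) + card (lnbh E x v (- x v))" if "x v \<noteq> 0" for v
  proof -
    have "x z \<noteq> x v \<longleftrightarrow> x z = 0 \<or> x z = - x v" for z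
      using that vals[of v] vals[of z] by auto
    then have "nbh F v = lnbh E x v 0 \<union> lnbh E x v (- x v)"
      by (auto simp: nbhF)
    then show ?thesis
      using that by (simp, subst card_Un_disjoint) auto
  qed
  have deg: "2 \<le> card (nbh F v)" if "v \<in> \<Union>F" for v
  proof (cases "x v = 0")
    case True
    have "card (nbh F v) \<noteq> 0"
      using that in_Union_iff_nbh[OF F(2)] by simp
    then show ?thesis
      using cardF0[OF True] by presburger
  next
    case False
    then show ?thesis
      using nonzero[OF False] cardF1[OF False] ge by linarith
  qed
  have "\<exists>c. cycle_on c (\<Union>F) F"
  proof (rule min_degree_unicyclic[OF F(2)])
    show "F \<noteq> {}"
      using uw F_iff[of u w] by auto
  qed (use deg unicyclic_unique[OF uni] F(1) in \<open>blast+\<close>)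
  then obtain c where c: "cycle_on c (\<Union>F) F" by blast
  note two = card_nbh_cycle[OF c]
  have nonzero_in: "v \<in> \<Union>F" if "x v \<noteq> 0" for v
  proof -
    have "card (nbh F v) \<noteq> 0"
      using nonzero[OF that] cardF1[OF that] ge by linarith
    then show ?thesis
      using in_Union_iff_nbh[OF F(2), of v] by auto
  qed
  \<comment> \<open>The vertex \<open>w\<close> has a soft neighbour, so of the two possible counts
    3 and 4 only 3 remains.\<close>
  have "u \<in> lnbh E x w 0"
    using uw by (simp add: nbh_def insert_commute)
  then have "card (lnbh E x w 0) \<noteq> 0"
    by (auto simp: card_eq_0_iff)
  moreover have "2 < card (lnbh E x w 0) + 2 * card (lnbh E x w (- x w))"
    using nonzero[OF uw(3)] ge by linarith
  ultimately have "card (lnbh E x w 0) + 2 * card (lnbh E x w (- x w)) = 3"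
    using cardF1[OF uw(3)] two[OF nonzero_in[OF uw(3)]] by linarith
  then show \<mu>: "\<mu> = 3"
    using nonzero[OF uw(3)] by linarith
  \<comment> \<open>Now a + b = 2 and a + 2b = 3 hold together, so a = b = 1.\<close>
  have one: "card (lnbh E x v 0) = 1" "card (lnbh E x v (- x v)) = 1" if "x v \<noteq> 0" for v
    using nonzero[OF that] cardF1[OF that] two[OF nonzero_in[OF that]] \<mu> by linarith+
  have C3k: "basic_C3k x (\<Union>F) F"
  proof -
    have "u \<in> \<Union>F"
      using uw F_iff[of u w] by auto
    then have "card (lnbh E x u 1) \<noteq> 0"
      using two[of u] cardF0[OF uw(2)] by linarith
    then have "lnbh E x u 1 \<noteq> {}"
      by (metis card.empty)
    then obtain p where p: "{p, u} \<in> F" "x p = 1"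
      using uw(2) by (auto simp: F_iff nbh_def insert_commute)
    show ?thesis
      using c p(1,2) uw(2)
    proof (rule basic_C3kI)
      fix v r assume v: "v \<in> \<Union>F" "r \<in> {-1, 0, 1}" "r \<noteq> x v"
      have "card (lnbh E x v r) \<noteq> 0"
      proof (cases "x v = 0")
        case True
        then have "card (lnbh E x v 1) \<noteq> 0"
          using two[OF v(1)] cardF0[OF True] by linarith
        moreover have "card (lnbh E x v r) = card (lnbh E x v 1)"
          using v zero[OF True] True by auto
        ultimately show ?thesis
          by metis
      next
        case False
        then have "r = 0 \<or> r = - x v"
          using v vals[of v] by auto
        then show ?thesis
          using one[OF False] by (metis zero_neq_one)
      qed
      then have "lnbh E x v r \<noteq> {}"
        by (metis card.empty)
      then show "\<exists>w\<in>nbh F v. x w = r"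
        using v(3) by (auto simp: nbhF)
    qed
  qed
  then have "obtained_from basic_C3k 3 x (\<Union>F) (unequal_edges x E)"
    unfolding F_def by (rule obtained_from.start)
  then have "obtained_from basic_C3k 3 x UNIV E"
    using simple
  proof (rule obtained_from_UNIV)
    show "connected_graph E"
      using uni by (simp add: unicyclic_def)
    show "\<Union>F \<noteq> {}"
      using nonzero_in[OF uw(3)] by auto
    show "x v = 0" if "v \<notin> \<Union>F" for v
      using that nonzero_in by blast
    then show "x v = 0" if "{v, w} \<in> E" "w \<notin> \<Union>F" for v w
      using that F_iff[of v w] by fastforce
  qed
  then show "obtained_from_C3k E"
    by (auto simp: obtained_from_C3k_def)
qed

lemma trivalent_classification:
  fixes E :: "'a::finite set set"
  assumes simple: "simple_graph E" and uni: "unicyclic E"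
    and aff: "affords \<mu> x UNIV E" and ran: "range x = {-1, 0, 1}"
  shows "\<mu> = 1 \<and> obtained_from_stars E \<or> \<mu> = 2 \<and> obtained_from_C4k E \<or>
    \<mu> = 3 \<and> obtained_from_C3k E"
proof -
  have conn: "connected_graph E"
    using uni by (simp add: unicyclic_def)
  obtain p q where pq: "x p = 0" "x q = 1"
    using ran by (metis imageE insertCI)
  obtain u w where uw: "{u, w} \<in> E" "x u = 0" "x w \<noteq> 0"
    using connected_graph_crossing[OF conn, of p "{v. x v = 0}" q] pq by auto
  have ran': "range x \<subseteq> {-1, 0, 1}"
    using ran by simp
  have "u \<in> lnbh E x w 0"
    using uw by (simp add: nbh_def insert_commute)
  then have "card (lnbh E x w 0) \<noteq> 0"
    by (auto simp: card_eq_0_iff)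
  \<comment> \<open>The eigenvalue read off at \<open>w\<close>; it is a positive integer because
    \<open>w\<close> has a soft neighbour.\<close>
  define m where "m = card (lnbh E x w 0) + 2 * card (lnbh E x w (- x w))"
  have "m \<noteq> 0"
    using \<open>card (lnbh E x w 0) \<noteq> 0\<close> unfolding m_def by linarith
  have \<mu>: "\<mu> = real m"
    using affords_counts(2)[OF aff ran' uw(3)] unfolding m_def ..
  from \<open>m \<noteq> 0\<close> consider "m = 1" | "m = 2" | "m > 2"
    by linarith
  then show ?thesis
  proof cases
    case 1
    with aff \<mu> show ?thesis
      using trivalent_classification_1[OF simple conn _ ran' uw] by simp
  next
    case 2
    with aff \<mu> show ?thesis
      using trivalent_classification_2[OF simple uni _ ran' uw] by simp
  next
    case 3
    then have "\<mu> > 2"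
      using \<mu> by simp
    then show ?thesis
      using trivalent_classification_3[OF simple uni aff ran' uw] by simp
  qed
qed

theorem theorem3p3:
  fixes E :: "'a::finite set set"
  assumes "simple_graph E" and "unicyclic E"
  shows
    "(bivalent E \<longleftrightarrow> linked_P2_chains E \<or> even_cycle E) \<and>
     (\<forall>\<mu>. bivalent_with E \<mu> \<longleftrightarrow>
        (\<mu> = 2 \<and> linked_P2_chains E) \<or> (\<mu> = 4 \<and> even_cycle E)) \<and>
     (trivalent E \<longleftrightarrow>
        obtained_from_stars E \<or> obtained_from_C4k E \<or> obtained_from_C3k E) \<and>
     (\<forall>\<mu>. trivalent_with E \<mu> \<longleftrightarrow>
        (\<mu> = 1 \<and> obtained_from_stars E) \<or>
        (\<mu> = 2 \<and> obtained_from_C4k E) \<or>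
        (\<mu> = 3 \<and> obtained_from_C3k E))"
proof -
  have bi: "bivalent_with E \<mu> \<longleftrightarrow> (\<mu> = 2 \<and> linked_P2_chains E) \<or> (\<mu> = 4 \<and> even_cycle E)" for \<mu>
  proof -
    have "bivalent_with E \<mu> \<longleftrightarrow> (\<exists>x. affords \<mu> x UNIV E \<and> range x = {-1, 1})"
      unfolding bivalent_with_def using assms(1) by (rule ex_eigenvector_iff_affords) auto
    also have "\<dots> \<longleftrightarrow> (\<mu> = 2 \<and> linked_P2_chains E) \<or> (\<mu> = 4 \<and> even_cycle E)"
      using bivalent_classification[OF assms] even_cycle_imp_affords[of E]
        affords_equal_linked_P2[of _ UNIV E]
      by (auto simp: linked_P2_chains_def) blast+
    finally show ?thesis .
  qed
  have tri: "trivalent_with E \<mu> \<longleftrightarrow> (\<mu> = 1 \<and> obtained_from_stars E) \<or>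
      (\<mu> = 2 \<and> obtained_from_C4k E) \<or> (\<mu> = 3 \<and> obtained_from_C3k E)" for \<mu>
  proof -
    have "trivalent_with E \<mu> \<longleftrightarrow> (\<exists>x. affords \<mu> x UNIV E \<and> range x = {-1, 0, 1})"
      unfolding trivalent_with_def using assms(1) by (rule ex_eigenvector_iff_affords) auto
    also have "\<dots> \<longleftrightarrow> (\<mu> = 1 \<and> obtained_from_stars E) \<or>
      (\<mu> = 2 \<and> obtained_from_C4k E) \<or> (\<mu> = 3 \<and> obtained_from_C3k E)" (is "?L \<longleftrightarrow> ?R")
    proof
      show "?L \<Longrightarrow> ?R"
        using trivalent_classification[OF assms] by blast
      \<comment> \<open>The converse for any family of initial graphs that satisfies the equation
        and takes all three values.\<close>
      have ex: "\<exists>x. affords \<nu> x UNIV E \<and> range x = {-1, 0, 1}"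
        if ob: "\<exists>x. obtained_from B \<nu> x UNIV E"
          and base: "\<And>x V E. B x V E \<Longrightarrow> affords \<nu> x V E \<and> x ` V = {-1, 0, 1}"
        for B :: "('a \<Rightarrow> real) \<Rightarrow> 'a set \<Rightarrow> 'a set set \<Rightarrow> bool" and \<nu>
      proof -
        obtain x where "obtained_from B \<nu> x UNIV E"
          using ob by blast
        from affords_obtained_from[OF this base] show ?thesis
          by blast
      qed
      assume ?R
      then show ?L
      proof (elim disjE conjE)
        assume \<mu>: "\<mu> = 1" and "obtained_from_stars E"
        then show ?L
          unfolding \<mu> obtained_from_stars_def
          by (elim ex) (simp add: affords_star)
      next
        assume \<mu>: "\<mu> = 2" and "obtained_from_C4k E"
        then show ?L
          unfolding \<mu> obtained_from_C4k_def
          by (elim ex) (auto simp: affords_C4k patterned_cycle_image)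
      next
        assume \<mu>: "\<mu> = 3" and "obtained_from_C3k E"
        then show ?L
          unfolding \<mu> obtained_from_C3k_def
          by (elim ex) (auto simp: affords_C3k patterned_cycle_image)
      qed
    qed
    finally show ?thesis .
  qed
  \<comment> \<open>The equivalences without an eigenvalue follow by taking
    \<open>\<exists>\<mu>\<close> over the refined ones.\<close>
  show ?thesis
    unfolding bivalent_def trivalent_def bi tri by blast
qed

end
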